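(* Let $Y=MN$ and $Y'=M'N'$ be two solutions in normal form at $+\infty$ of one and the same regular singular system $Y(x-1)=B(x)Y(x)$, $B\in GL_n(\mathbb{C}(x))$. Then $N'=N$, and there exists $R\in GL_n(\mathbb{C})$ commuting with $N$ such that $M'=MR$.
   Context: A rational system $Y(x-1)=B(x)Y(x)$, $B\in GL_n(\mathbb{C}(x))$, is Fuchsian if $B$ is holomorphic at $\infty$ and $B(\infty)=I$; it is regular singular if there is $R\in GL_n(\mathbb{C}(x))$ such that the system with matrix $R(x-1)^{-1}B(x)R(x)$ is Fuchsian. $x^{-[k]}=\frac{1}{x(x+1)\cdots(x+k-1)}$ ($x^{-[0]}=1$). $\mathcal{O}_{fact}$ is the ring of functions given on some right half-plane by convergent series $\sum_{k\ge0}a_kx^{-[k]}$; $\mathcal{M}_{fact}$ is its fraction field; $\mathcal{M}_{fact}(\mathbb{C})$ is the subfield of its elements that are meromorphic on all of $\mathbb{C}$. Put $e_c^+(x)=\Gamma(x)/\Gamma(x-c)$ and $l_c^{(k)}(x)=\frac1{k!}\frac{\partial^k}{\partial c^k}e_c^+(x)$. Let $N_\mu$ be the $\mu\times\mu$ nilpotent Jordan block (ones on the superdiagonal), and $e^+_{cI_\mu+N_\mu}$ the upper triangular Toeplitz matrix with $(i,j)$ entry $l_c^{(j-i)}$ for $j\ge i$. Let $\mathcal{B}=\{c:0<\mathrm{Re}(c)\le1\}$, and fix the total order on $\mathbb{C}$: $x\prec y$ iff $\mathrm{Re}\,x<\mathrm{Re}\,y$, or $\mathrm{Re}\,x=\mathrm{Re}\,y$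 and $\mathrm{Im}\,x<\mathrm{Im}\,y$. A solution at $+\infty$ is in normal form if it is a product $MN$ with $M\in GL_n(\mathcal{M}_{fact}(\mathbb{C}))$ and $N$ block-diagonal with diagonal blocks of the form $e^+_{cI_\mu+N_\mu}$, $c\in\mathcal{B}$, with the $c$'s arranged in increasing order and, for each fixed $c$, the sizes of the blocks arranged in increasing order. *)

theory Defs
  imports "HOL-Complex_Analysis.Complex_Analysis" "Jordan_Normal_Form.Matrix"
begin

text \<open>
  A meromorphic function on the complex plane is represented by any total function
  complex => complex that is \<open>meromorphic_on UNIV\<close>; its values on a sparse set (in particular at
  its poles) carry no meaning. Accordingly, an identity between meromorphic functions, or between
  matrices of such functions, is required outside a sparse set only, which is written
  \<open>\<forall>\<^sub>\<approx>x. \<dots>\<close>. A matrix of functions is a function \<open>complex \<Rightarrow> complex mat\<close>.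
\<close>

text \<open>\<open>GL_n(F)\<close> for a field \<open>F\<close> of functions, the inverse being taken over \<open>F\<close>.\<close>

definition fun_mat :: "nat \<Rightarrow> (complex \<Rightarrow> complex) set \<Rightarrow> (complex \<Rightarrow> complex mat) set" where
  "fun_mat n F = {A. (\<forall>x. A x \<in> carrier_mat n n) \<and>
                     (\<forall>i<n. \<forall>j<n. (\<lambda>x. A x $$ (i, j)) \<in> F)}"

definition inverse_fun_mats ::
    "nat \<Rightarrow> (complex \<Rightarrow> complex mat) \<Rightarrow> (complex \<Rightarrow> complex mat) \<Rightarrow> bool" where
  "inverse_fun_mats n A A' \<longleftrightarrow> (\<forall>\<^sub>\<approx>x. A x * A' x = 1\<^sub>m n \<and> A' x * A x = 1\<^sub>m n)"

definition GL :: "nat \<Rightarrow> (complex \<Rightarrow> complex) set \<Rightarrow> (complex \<Rightarrow> complex mat) set" where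
  "GL n F = {A \<in> fun_mat n F. \<exists>A'\<in>fun_mat n F. inverse_fun_mats n A A'}"

text \<open>
  The field \<open>\<complex>(x)\<close>. The exceptional set is finite (not just sparse), so that the germ at infinity
  of a representing function is determined.
\<close>

definition rational_functions :: "(complex \<Rightarrow> complex) set" where
  "rational_functions =
     {f. \<exists>p q. q \<noteq> 0 \<and> (\<forall>x. poly q x \<noteq> 0 \<longrightarrow> f x = poly p x / poly q x)}"

definition holomorphic_at_infinity_with_value :: "(complex \<Rightarrow> complex) \<Rightarrow> complex \<Rightarrow> bool" where
  "holomorphic_at_infinity_with_value f a \<longleftrightarrow>
     (\<exists>g. g analytic_on {0} \<and> g 0 = a \<and> (\<forall>\<^sub>F w in at 0. g w = f (inverse w)))"

definition Fuchsian :: "nat \<Rightarrow> (complex \<Rightarrow> complex mat) \<Rightarrow> bool" where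
  "Fuchsian n B \<longleftrightarrow> B \<in> GL n rational_functions \<and>
     (\<forall>i<n. \<forall>j<n. holomorphic_at_infinity_with_value (\<lambda>x. B x $$ (i, j)) (1\<^sub>m n $$ (i, j)))"

text \<open>In the next definition, \<open>S\<close> is the matrix \<open>R(x-1)\<^sup>-\<^sup>1\<close>.\<close>

definition regular_singular :: "nat \<Rightarrow> (complex \<Rightarrow> complex mat) \<Rightarrow> bool" where
  "regular_singular n B \<longleftrightarrow>
     (\<exists>R\<in>GL n rational_functions. \<exists>S\<in>GL n rational_functions.
        inverse_fun_mats n (\<lambda>x. R (x - 1)) S \<and> Fuchsian n (\<lambda>x. S x * B x * R x))"

definition solves_system ::
    "(complex \<Rightarrow> complex mat) \<Rightarrow> (complex \<Rightarrow> complex mat) \<Rightarrow> bool" where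
  "solves_system B Y \<longleftrightarrow> (\<forall>\<^sub>\<approx>x. Y (x - 1) = B x * Y x)"

text \<open>
  Only the values on a right half-plane matter for membership in \<open>O_fact\<close>. The half-plane can
  always be shrunk; \<open>A \<ge> 0\<close> keeps it away from the zeros of \<open>pochhammer x k\<close>.
\<close>

definition O_fact :: "(complex \<Rightarrow> complex) set" where
  "O_fact = {f. \<exists>a A. A \<ge> 0 \<and>
               (\<forall>x. Re x > A \<longrightarrow> (\<lambda>k. a k * inverse (pochhammer x k)) sums f x)}"

text \<open>
  The fraction field: quotients \<open>g / h\<close> on some right half-plane, where \<open>h\<close> is not zero as an
  element of \<open>O_fact\<close>, i.e. does not vanish identically on any right half-plane.
\<close>

definition M_fact :: "(complex \<Rightarrow> complex) set" where
  "M_fact = {f. \<exists>g\<in>O_fact. \<exists>h\<in>O_fact. \<not> (\<exists>A. \<forall>x. Re x > A \<longrightarrow> h x = 0) \<and>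
               (\<exists>A. \<forall>\<^sub>\<approx>x\<in>{x. Re x > A}. f x = g x / h x)}"

definition M_fact_C :: "(complex \<Rightarrow> complex) set" where
  "M_fact_C = {f \<in> M_fact. f meromorphic_on UNIV}"

text \<open>
  Where \<open>x - c\<close> is a pole of \<open>Gamma\<close>, the library has \<open>Gamma (x - c) = 0\<close> and hence
  \<open>Gamma x / Gamma (x - c) = 0\<close>, which is the correct value. So for every \<open>x\<close> outside the
  nonpositive integers this is an entire function of \<open>c\<close>.
\<close>

definition e_plus :: "complex \<Rightarrow> complex \<Rightarrow> complex" where
  "e_plus c x = Gamma x / Gamma (x - c)"

definition l_plus :: "nat \<Rightarrow> complex \<Rightarrow> complex \<Rightarrow> complex" where
  "l_plus k c x = (deriv ^^ k) (\<lambda>c. e_plus c x) c / fact k"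

definition e_plus_block :: "complex \<times> nat \<Rightarrow> complex \<Rightarrow> complex mat" where
  "e_plus_block = (\<lambda>(c, \<mu>) x.
     mat \<mu> \<mu> (\<lambda>(i, j). if i \<le> j then l_plus (j - i) c x else 0))"

definition prec :: "complex \<Rightarrow> complex \<Rightarrow> bool" where
  "prec x y \<longleftrightarrow> Re x < Re y \<or> Re x = Re y \<and> Im x < Im y"

text \<open>
  A list of pairs \<open>(c, \<mu>)\<close> describes the diagonal blocks, from top left to bottom right. Several
  blocks may share the same \<open>c\<close> and the same size, so the orderings are the non-strict ones.
\<close>

definition block_data :: "nat \<Rightarrow> (complex \<times> nat) list \<Rightarrow> bool" where
  "block_data n bs \<longleftrightarrow>
     (\<forall>(c, \<mu>)\<in>set bs. 0 < Re c \<and> Re c \<le> 1 \<and> 0 < \<mu>) \<and>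
     sum_list (map snd bs) = n \<and>
     sorted_wrt (\<lambda>(c, \<mu>) (c', \<mu>'). prec c c' \<or> c = c' \<and> \<mu> \<le> \<mu>') bs"

definition normal_factor :: "nat \<Rightarrow> (complex \<Rightarrow> complex mat) \<Rightarrow> bool" where
  "normal_factor n N \<longleftrightarrow>
     (\<exists>bs. block_data n bs \<and> N = (\<lambda>x. diag_block_mat (map (\<lambda>b. e_plus_block b x) bs)))"

definition normal_form_solution ::
    "nat \<Rightarrow> (complex \<Rightarrow> complex mat) \<Rightarrow> (complex \<Rightarrow> complex mat) \<Rightarrow>
     (complex \<Rightarrow> complex mat) \<Rightarrow> (complex \<Rightarrow> complex mat) \<Rightarrow> bool" where
  "normal_form_solution n B Y M N \<longleftrightarrow>
     solves_system B Y \<and> M \<in> GL n M_fact_C \<and> normal_factor n N \<and> (\<forall>\<^sub>\<approx>x. Y x = M x * N x)"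

end

theory Submission
  imports Defs "Jordan_Normal_Form.Jordan_Normal_Form_Uniqueness"
begin

text \<open>
  Write \<open>D\<close> for the constant Jordan matrix with the same blocks as \<open>N\<close>. Then
  \<open>N(x-1) = (I - D/(x-1)) N(x)\<close>, so \<open>P = M\<^sup>-\<^sup>1 M'\<close> satisfies
  \<open>P(x-1) (I - D'/(x-1)) = (I - D/(x-1)) P(x)\<close>. As \<open>D\<close> and \<open>D'\<close> are bidiagonal, the entries of \<open>P\<close>
  can be treated one after the other, each as a solution of a scalar equation
  \<open>f(x-1) (x-1-d') = (x-1-d) f(x) + r\<close> with constant \<open>r\<close>. A factorial series, hence also a sum of
  products of elements of \<open>M_fact\<close>, is approximated to every order by rational functions as
  \<open>x \<rightarrow> +\<infinity>\<close>; so \<open>f\<close> has a leading term \<open>L x\<^sup>-\<^sup>k\<close> with integral \<open>k\<close>, or decays faster than every power.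
  Comparing leading terms, and using that \<open>d' - d\<close> is never a nonzero integer on the strip
  \<open>0 < Re c \<le> 1\<close>, shows that \<open>f\<close> minus its limit decays faster than every power; but a nonzero
  solution of the homogeneous equation decays at most polynomially along \<open>t, t + 1, \<dots>\<close>. Thus
  \<open>P\<close> is a constant \<open>R\<close> with \<open>D R = R D'\<close>, and the uniqueness of the Jordan normal form gives
  \<open>D = D'\<close>.
\<close>

section \<open>Limits at the right end of the real line\<close>

text \<open>Identities between meromorphic functions hold off a countable set, and a countable set, unlike
  a sparse one, may be removed together with all its integer translates.\<close>

definition cocountable :: "complex filter" where
  "cocountable = Abs_filter (\<lambda>P. countable {x. \<not> P x})"

lemma eventually_cocountable: "eventually P cocountable \<longleftrightarrow> countable {x. \<not> P x}"
  unfolding cocountable_def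
proof (rule eventually_Abs_filter, unfold_locales)
  show "countable {x::complex. \<not> (P x \<and> Q x)}"
    if "countable {x. \<not> P x}" "countable {x. \<not> Q x}" for P Q
    using countable_Un[OF that] by (rule countable_subset[rotated]) auto
  show "countable {x::complex. \<not> Q x}"
    if "\<forall>x. P x \<longrightarrow> Q x" "countable {x. \<not> P x}" for P Q
    using that(2) by (rule countable_subset[rotated]) (use that(1) in auto)
qed simp

lemma cocountable_le_cosparse: "cocountable \<le> cosparse UNIV"
proof (rule filter_leI)
  fix P :: "complex \<Rightarrow> bool" assume "eventually P (cosparse UNIV)"
  then show "eventually P cocountable"
    using sparse_imp_countable[of UNIV "{x. \<not> P x}"]
    by (simp add: eventually_cocountable eventually_cosparse)
qed

lemma eventually_cosparse_imp_cocountable: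
  "eventually P (cosparse UNIV) \<Longrightarrow> eventually P cocountable"
  using cocountable_le_cosparse by (rule filter_leD)

lemma eventually_cocountable_shift:
  assumes "eventually P cocountable"
  shows "eventually (\<lambda>x. P (x - a)) cocountable"
proof -
  have "{x. \<not> P (x - a)} = (\<lambda>x. x + a) ` {x. \<not> P x}"
    by (auto intro!: image_eqI[of _ _ "_ - a"])
  then show ?thesis
    using assms by (simp add: eventually_cocountable)
qed

text \<open>Approach along the real axis suffices, since the difference equations link points that
  differ by integers. The infimum with \<open>cocountable\<close> is there because exceptional
  sparse sets, such as sets of poles, may contain arbitrarily large real points.\<close>

definition right_end :: "complex filter" where
  "right_end = inf (filtermap complex_of_real at_top) cocountable"

lemma eventually_cocountable_imp_right_end:
  "eventually P cocountable \<Longrightarrow> eventually P right_end"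
  unfolding right_end_def by (rule filter_leD[OF inf_le2])

lemma eventually_right_end:
  "eventually P right_end \<longleftrightarrow>
     (\<exists>X Z. countable Z \<and> (\<forall>t>X. complex_of_real t \<notin> Z \<longrightarrow> P (complex_of_real t)))"
proof
  assume "eventually P right_end"
  then obtain Q R where Q: "eventually (\<lambda>t. Q (complex_of_real t)) at_top"
    and R: "countable {x. \<not> R x}" and QR: "\<And>x. Q x \<Longrightarrow> R x \<Longrightarrow> P x"
    unfolding right_end_def eventually_inf eventually_filtermap eventually_cocountable by blast
  from Q obtain X where "\<And>t. t > X \<Longrightarrow> Q (complex_of_real t)"
    unfolding eventually_at_top_dense by blast
  with R QR show "\<exists>X Z. countable Z \<and> (\<forall>t>X. complex_of_real t \<notin> Z \<longrightarrow> P (complex_of_real t))"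
    by (intro exI[of _ X] exI[of _ "{x. \<not> R x}"]) auto
next
  assume "\<exists>X Z. countable Z \<and> (\<forall>t>X. complex_of_real t \<notin> Z \<longrightarrow> P (complex_of_real t))"
  then obtain X Z where Z: "countable Z"
    and P: "\<And>t. t > X \<Longrightarrow> complex_of_real t \<notin> Z \<Longrightarrow> P (complex_of_real t)" by blast
  show "eventually P right_end"
    unfolding right_end_def eventually_inf eventually_filtermap eventually_cocountable
  proof (intro exI conjI allI impI)
    show "eventually (\<lambda>t. \<exists>s>X. complex_of_real t = complex_of_real s) at_top"
      unfolding eventually_at_top_dense by blast
    show "countable {x. \<not> x \<notin> Z}" using Z by simp
  qed (use P in auto)
qed

lemma eventually_right_endI:
  assumes "\<And>t. t > X \<Longrightarrow> P (complex_of_real t)"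
  shows "eventually P right_end"
  unfolding eventually_right_end using assms by (intro exI[of _ X] exI[of _ "{}"]) auto

text \<open>For each natural \<open>m\<close> only countably many real \<open>t\<close> have
  \<open>t + m\<close> exceptional; the union over \<open>m\<close> is countable and cannot fill an
  interval.\<close>

lemma ex_generic_real:
  assumes "eventually P cocountable"
  obtains t where "t > X" "\<And>m::nat. P (complex_of_real t + of_nat m)"
proof -
  define Z where "Z = (\<Union>m::nat. {t::real. \<not> P (complex_of_real t + of_nat m)})"
  have "countable {t::real. \<not> P (complex_of_real t + of_nat m)}" for m
  proof -
    have "(\<lambda>t. complex_of_real t + of_nat m) ` {t::real. \<not> P (complex_of_real t + of_nat m)}
            \<subseteq> {x. \<not> P x}" by auto
    then have "countable ((\<lambda>t. complex_of_real t + of_nat m) ` {t. \<not> P (complex_of_real t + of_nat m)})"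
      using assms countable_subset unfolding eventually_cocountable by blast
    then show ?thesis
      by (rule countable_image_inj_on) (auto simp: inj_on_def)
  qed
  then have "countable Z" unfolding Z_def by blast
  moreover have "uncountable {X<..<X+1}" by (rule uncountable_open_interval[THEN iffD2]) simp
  ultimately have "\<not> {X<..<X+1} \<subseteq> Z" using countable_subset by blast
  then obtain t where "t \<in> {X<..<X+1}" "t \<notin> Z" by blast
  then show ?thesis by (intro that[of t]) (auto simp: Z_def)
qed

text \<open>Since countably many conditions can be imposed on \<open>t\<close>, a limit at \<open>right_end\<close> is also
  a limit along \<open>t, t + 1, t + 2, \<dots>\<close> for generic \<open>t\<close>.\<close>

lemma tendsto_right_end_generic:
  fixes f :: "complex \<Rightarrow> 'a::metric_space"
  assumes "(f \<longlongrightarrow> L) right_end"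
  obtains Z where "countable Z"
    "\<And>t. (\<And>m::nat. complex_of_real t + of_nat m \<notin> Z) \<Longrightarrow>
        (\<lambda>m. f (complex_of_real t + of_nat m)) \<longlonglongrightarrow> L"
proof -
  \<comment> \<open>Each tolerance \<open>1/(n+1)\<close> has its own countable exceptional set; the
    union over \<open>n\<close> serves all tolerances at once.\<close>
  have "\<forall>n. \<exists>X Z. countable Z \<and> (\<forall>t>X. complex_of_real t \<notin> Z \<longrightarrow>
            dist (f (complex_of_real t)) L < inverse (real (Suc n)))"
    using tendstoD[OF assms] unfolding eventually_right_end by simp
  then obtain X Z where Z: "\<And>n::nat. countable (Z n)"
    and X: "\<And>n t. t > X n \<Longrightarrow> complex_of_real t \<notin> Z n \<Longrightarrow>
              dist (f (complex_of_real t)) L < inverse (real (Suc n))" by metis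
  show ?thesis
  proof (rule that)
    show "countable (\<Union>n. Z n)" using Z by blast
    fix t assume t: "\<And>m::nat. complex_of_real t + of_nat m \<notin> (\<Union>n. Z n)"
    show "(\<lambda>m. f (complex_of_real t + of_nat m)) \<longlonglongrightarrow> L"
    proof (rule tendstoI)
      fix e :: real assume "e > 0"
      then obtain n where n: "inverse (real (Suc n)) < e" using reals_Archimedean by blast
      have "eventually (\<lambda>m. t + real m > X n) sequentially"
        by real_asymp
      then show "eventually (\<lambda>m. dist (f (complex_of_real t + of_nat m)) L < e) sequentially"
      proof eventually_elim
        case (elim m)
        have "complex_of_real (t + real m) \<notin> Z n" using t[of m] by auto
        from X[OF elim this] show ?case using n by simp
      qed
    qed
  qed
qed

lemma right_end_nontrivial [simp]: "right_end \<noteq> bot"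
proof -
  have "\<not> eventually (\<lambda>_. False) right_end"
  proof
    assume "eventually (\<lambda>_. False) right_end"
    then obtain X Z where Z: "countable Z" "\<And>t. t > X \<Longrightarrow> complex_of_real t \<in> Z"
      unfolding eventually_right_end by blast
    have "eventually (\<lambda>x. x \<notin> Z) cocountable" using Z by (simp add: eventually_cocountable)
    then obtain t where "t > X" "\<And>m::nat. complex_of_real t + of_nat m \<notin> Z"
      using ex_generic_real[of "\<lambda>x. x \<notin> Z" X] by metis
    then show False using Z(2)[of t] by (metis add.right_neutral of_nat_0)
  qed
  then show ?thesis by auto
qed

lemma right_end_le_at_infinity: "right_end \<le> at_infinity"
proof (rule filter_leI)
  fix P :: "complex \<Rightarrow> bool" assume "eventually P at_infinity"
  then obtain b where "\<And>x. b \<le> norm x \<Longrightarrow> P x" unfolding eventually_at_infinity by blast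
  then show "eventually P right_end"
    by (intro eventually_right_endI[of b]) auto
qed

lemma eventually_right_end_nonzero: "eventually (\<lambda>x. x \<noteq> 0) right_end"
  by (rule eventually_right_endI[of 0]) auto

lemma tendsto_at_infinity_imp_right_end:
  "(f \<longlongrightarrow> L) at_infinity \<Longrightarrow> (f \<longlongrightarrow> L) right_end"
  using right_end_le_at_infinity by (rule tendsto_mono)

lemma eventually_poly_nonzero:
  assumes "p \<noteq> 0"
  shows "eventually (\<lambda>x::complex. poly p x \<noteq> 0) right_end"
proof -
  have "eventually (\<lambda>x. poly p x \<noteq> 0) cocountable"
    using poly_roots_finite[OF assms] by (simp add: eventually_cocountable countable_finite)
  then show ?thesis by (rule eventually_cocountable_imp_right_end)
qed

section \<open>Rational approximation\<close>

abbreviation Oinf :: "int \<Rightarrow> (complex \<Rightarrow> complex) set" where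
  "Oinf k \<equiv> O[right_end](\<lambda>x. x powi k)"

lemma Oinf_mult:
  assumes "f \<in> Oinf a" "g \<in> Oinf b"
  shows "(\<lambda>x. f x * g x) \<in> Oinf (a + b)"
proof -
  have "(\<lambda>x. f x * g x) \<in> O[right_end](\<lambda>x. x powi a * x powi b)"
    using assms by (rule landau_o.big.mult)
  moreover have "eventually (\<lambda>x::complex. x powi a * x powi b = x powi (a + b)) right_end"
    using eventually_right_end_nonzero by eventually_elim (simp add: power_int_add)
  ultimately show ?thesis by (subst (asm) landau_o.big.cong)
qed

lemma Oinf_mono_fun:
  assumes "a \<le> b"
  shows "(\<lambda>x. x powi a) \<in> Oinf b"
proof (rule bigoI[of _ 1])
  show "eventually (\<lambda>x::complex. norm (x powi a) \<le> 1 * norm (x powi b)) right_end"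
    by (rule eventually_right_endI[of 1])
       (use assms in \<open>auto simp: norm_power_int intro!: power_int_increasing\<close>)
qed

lemma Oinf_mono:
  assumes "f \<in> Oinf a" "a \<le> b"
  shows "f \<in> Oinf b"
  using assms(1) Oinf_mono_fun[OF assms(2)] by (rule landau_o.big_trans)

lemma tendsto_inverse_right_end: "((\<lambda>x. inverse x) \<longlongrightarrow> 0) right_end"
  using tendsto_inverse_0 by (rule tendsto_at_infinity_imp_right_end)

lemma tendsto_powi_neg:
  assumes "k < 0"
  shows "((\<lambda>x::complex. x powi k) \<longlongrightarrow> 0) right_end"
proof -
  have "((\<lambda>x::complex. inverse x ^ nat (- k)) \<longlongrightarrow> 0 ^ nat (- k)) right_end"
    by (intro tendsto_intros tendsto_inverse_right_end)
  then show ?thesis using assms by (simp add: power_int_def zero_power)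
qed

lemma Oinf_neg_tendsto:
  assumes "f \<in> Oinf k" "k < 0"
  shows "(f \<longlongrightarrow> 0) right_end"
proof -
  from landau_o.bigE[OF assms(1)] obtain c where
    c: "c > 0" "eventually (\<lambda>x. norm (f x) \<le> c * norm (x powi k)) right_end" by blast
  have "((\<lambda>x. c * norm (x powi k)) \<longlongrightarrow> c * norm (0::complex)) right_end"
    by (intro tendsto_intros tendsto_powi_neg assms)
  then show ?thesis by (intro Lim_null_comparison[OF c(2)]) simp
qed

lemma tendsto_powi_imp_Oinf:
  assumes "((\<lambda>x. f x * x powi k) \<longlongrightarrow> L) right_end"
  shows "f \<in> Oinf (- k)"
proof (rule bigoI_tendsto[of _ _ L])
  show "eventually (\<lambda>x::complex. x powi (- k) \<noteq> 0) right_end"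
    using eventually_right_end_nonzero by eventually_elim simp
  show "((\<lambda>x. f x / x powi (- k)) \<longlongrightarrow> L) right_end"
    using assms by (simp add: power_int_minus field_simps)
qed

lemma rational_leading_term:
  assumes "p \<noteq> 0" "q \<noteq> 0"
  shows "\<exists>k L. L \<noteq> 0 \<and>
    ((\<lambda>x::complex. poly p x / poly q x * x powi k) \<longlongrightarrow> L) right_end"
proof (intro exI conjI)
  show "lead_coeff p / lead_coeff q \<noteq> 0" using assms by simp
  have "((\<lambda>x. (poly p x / x ^ degree p) / (poly q x / x ^ degree q))
          \<longlongrightarrow> lead_coeff p / lead_coeff q) right_end"
    using assms by (intro tendsto_divide tendsto_at_infinity_imp_right_end[OF poly_divide_tendsto_aux]) auto
  moreover have "eventually (\<lambda>x. (poly p x / x ^ degree p) / (poly q x / x ^ degree q) =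
      poly p x / poly q x * x powi (int (degree q) - int (degree p))) right_end"
    using eventually_right_end_nonzero by eventually_elim (simp add: power_int_diff)
  ultimately show "((\<lambda>x. poly p x / poly q x * x powi (int (degree q) - int (degree p)))
      \<longlongrightarrow> lead_coeff p / lead_coeff q) right_end"
    by (rule Lim_transform_eventually)
qed

lemma rational_Oinf:
  assumes "q \<noteq> 0"
  shows "\<exists>k. (\<lambda>x. poly p x / poly q x) \<in> Oinf k"
proof (cases "p = 0")
  case False
  from rational_leading_term[OF this assms] obtain k L
    where "((\<lambda>x. poly p x / poly q x * x powi k) \<longlongrightarrow> L) right_end" by blast
  from tendsto_powi_imp_Oinf[OF this] show ?thesis by (rule exI)
qed simp

text \<open>The approximant may change with the order \<open>k\<close>. Rational functions are more
  convenient here than truncated power series in \<open>1/x\<close>: partial sums of factorial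
  series are rational as they stand, and the reciprocal of a nonzero approximant is again
  rational.\<close>

definition rationally_approximable :: "(complex \<Rightarrow> complex) \<Rightarrow> bool" where
  "rationally_approximable f \<longleftrightarrow>
     (\<forall>k. \<exists>p q. q \<noteq> 0 \<and> (\<lambda>x. f x - poly p x / poly q x) \<in> Oinf k)"

lemma rationally_approximableE:
  assumes "rationally_approximable f"
  obtains p q where "q \<noteq> 0" "(\<lambda>x. f x - poly p x / poly q x) \<in> Oinf k"
  using assms unfolding rationally_approximable_def by blast

section \<open>Closure of rational approximability under algebraic operations\<close>

lemma rationally_approximable_cong:
  assumes "eventually (\<lambda>x. f x = g x) right_end" "rationally_approximable f"
  shows "rationally_approximable g"
  unfolding rationally_approximable_def
proof
  fix k
  from assms(2) obtain p q where "q \<noteq> 0" and *: "(\<lambda>x. f x - poly p x / poly q x) \<in> Oinf k"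
    by (rule rationally_approximableE)
  have "eventually (\<lambda>x. f x - poly p x / poly q x = g x - poly p x / poly q x) right_end"
    using assms(1) by eventually_elim simp
  from * this have "(\<lambda>x. g x - poly p x / poly q x) \<in> Oinf k"
    by (subst (asm) landau_o.big.in_cong)
  with \<open>q \<noteq> 0\<close> show "\<exists>p q. q \<noteq> 0 \<and> (\<lambda>x. g x - poly p x / poly q x) \<in> Oinf k" by blast
qed

lemma rationally_approximable_const: "rationally_approximable (\<lambda>_. c)"
  unfolding rationally_approximable_def
  by (intro allI exI[of _ "[:c:]"] exI[of _ 1]) auto

lemma rationally_approximable_Oinf:
  assumes "rationally_approximable f"
  shows "\<exists>k. f \<in> Oinf k"
proof -
  from assms obtain p q where q: "q \<noteq> 0" and *: "(\<lambda>x. f x - poly p x / poly q x) \<in> Oinf 0"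
    by (rule rationally_approximableE)
  from rational_Oinf[OF q] obtain k where k: "(\<lambda>x. poly p x / poly q x) \<in> Oinf k" by blast
  have "(\<lambda>x. (f x - poly p x / poly q x) + poly p x / poly q x) \<in> Oinf (max 0 k)"
    by (intro sum_in_bigo(1) Oinf_mono[OF *] Oinf_mono[OF k]) simp_all
  then have "f \<in> Oinf (max 0 k)" by simp
  then show ?thesis by (rule exI)
qed

lemma rationally_approximable_add:
  assumes "rationally_approximable f" "rationally_approximable g"
  shows "rationally_approximable (\<lambda>x. f x + g x)"
  unfolding rationally_approximable_def
proof
  fix k
  obtain p q where q: "q \<noteq> 0" and 1: "(\<lambda>x. f x - poly p x / poly q x) \<in> Oinf k"
    using assms(1) by (rule rationally_approximableE)
  obtain r s where s: "s \<noteq> 0" and 2: "(\<lambda>x. g x - poly r x / poly s x) \<in> Oinf k"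
    using assms(2) by (rule rationally_approximableE)
  have "eventually (\<lambda>x. (f x - poly p x / poly q x) + (g x - poly r x / poly s x) =
          f x + g x - poly (p * s + r * q) x / poly (q * s) x) right_end"
    using eventually_poly_nonzero[OF q] eventually_poly_nonzero[OF s]
    by eventually_elim (simp add: field_simps)
  with sum_in_bigo(1)[OF 1 2]
  have "(\<lambda>x. f x + g x - poly (p * s + r * q) x / poly (q * s) x) \<in> Oinf k"
    by (subst (asm) landau_o.big.in_cong)
  moreover have "q * s \<noteq> 0" using q s by simp
  ultimately show "\<exists>p q. q \<noteq> 0 \<and> (\<lambda>x. f x + g x - poly p x / poly q x) \<in> Oinf k" by blast
qed

lemma rationally_approximable_mult:
  assumes "rationally_approximable f" "rationally_approximable g"
  shows "rationally_approximable (\<lambda>x. f x * g x)"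
  unfolding rationally_approximable_def
proof
  fix k
  from rationally_approximable_Oinf[OF assms(1)] obtain a where a: "f \<in> Oinf a" by blast
  \<comment> \<open>The growth orders \<open>a\<close> of \<open>f\<close> and \<open>b\<close> of
    the approximant of \<open>g\<close> are subtracted from the required accuracies, so that both
    terms of \<open>f (g - r/s) + (f - p/q) (r/s)\<close> have order \<open>k\<close>.\<close>
  obtain r s where s: "s \<noteq> 0" and 2: "(\<lambda>x. g x - poly r x / poly s x) \<in> Oinf (k - a)"
    using assms(2) by (rule rationally_approximableE)
  from rational_Oinf[OF s] obtain b where b: "(\<lambda>x. poly r x / poly s x) \<in> Oinf b" by blast
  obtain p q where q: "q \<noteq> 0" and 1: "(\<lambda>x. f x - poly p x / poly q x) \<in> Oinf (k - b)"
    using assms(1) by (rule rationally_approximableE)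
  have "(\<lambda>x. f x * (g x - poly r x / poly s x) +
          (f x - poly p x / poly q x) * (poly r x / poly s x)) \<in> Oinf k"
    using Oinf_mult[OF a 2] Oinf_mult[OF 1 b] by (intro sum_in_bigo(1)) simp_all
  moreover have "(\<lambda>x. f x * (g x - poly r x / poly s x) +
          (f x - poly p x / poly q x) * (poly r x / poly s x)) =
        (\<lambda>x. f x * g x - poly (p * r) x / poly (q * s) x)"
    by (auto simp: algebra_simps)
  moreover have "q * s \<noteq> 0" using q s by simp
  ultimately show "\<exists>p q. q \<noteq> 0 \<and> (\<lambda>x. f x * g x - poly p x / poly q x) \<in> Oinf k" by metis
qed

lemma rationally_approximable_sum:
  assumes "\<And>i. i \<in> I \<Longrightarrow> rationally_approximable (f i)"
  shows "rationally_approximable (\<lambda>x. \<Sum>i\<in>I. f i x)"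
  using assms
  by (induction I rule: infinite_finite_induct)
     (auto intro: rationally_approximable_const rationally_approximable_add)

text \<open>From \<open>1/h - q/p = - (h - p/q) (1/h) (q/p)\<close>: the leading term of
  \<open>h\<close> bounds \<open>1/h\<close>, and the same bound holds for \<open>q/p\<close> once
  the approximation is fine enough for \<open>p/q\<close> to share that leading term.\<close>

lemma rationally_approximable_inverse:
  assumes "rationally_approximable h"
    and lim: "((\<lambda>x. h x * x powi j) \<longlongrightarrow> L) right_end" and "L \<noteq> 0"
  shows "rationally_approximable (\<lambda>x. inverse (h x))"
  unfolding rationally_approximable_def
proof
  fix k
  have inverse_Oinf: "(\<lambda>x. inverse (g x)) \<in> Oinf j \<and> eventually (\<lambda>x. g x \<noteq> 0) right_end"
    if "((\<lambda>x. g x * x powi j) \<longlongrightarrow> L) right_end" for g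
  proof
    have "((\<lambda>x. inverse (g x * x powi j)) \<longlongrightarrow> inverse L) right_end"
      using that \<open>L \<noteq> 0\<close> by (rule tendsto_inverse)
    then have "((\<lambda>x. inverse (g x) * x powi (- j)) \<longlongrightarrow> inverse L) right_end"
      by (simp add: power_int_minus)
    from tendsto_powi_imp_Oinf[OF this] show "(\<lambda>x. inverse (g x)) \<in> Oinf j" by simp
    from tendsto_imp_eventually_ne[OF that \<open>L \<noteq> 0\<close>]
    show "eventually (\<lambda>x. g x \<noteq> 0) right_end" by eventually_elim auto
  qed
  \<comment> \<open>\<open>m < - j\<close> makes the error too small to disturb the leading term;
    \<open>m + 2 * j \<le> k\<close> leaves accuracy \<open>k\<close> after two divisions, each
    costing \<open>j\<close>.\<close>
  define m where "m = min (- j - 1) (k - 2 * j)"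
  obtain p q where q: "q \<noteq> 0" and 1: "(\<lambda>x. h x - poly p x / poly q x) \<in> Oinf m"
    using assms(1) by (rule rationally_approximableE)
  have "(\<lambda>x. (h x - poly p x / poly q x) * x powi j) \<in> Oinf (m + j)"
    using 1 by (intro Oinf_mult) auto
  then have "((\<lambda>x. (h x - poly p x / poly q x) * x powi j) \<longlongrightarrow> 0) right_end"
    by (rule Oinf_neg_tendsto) (simp add: m_def)
  from tendsto_diff[OF lim this]
  have lim': "((\<lambda>x. poly p x / poly q x * x powi j) \<longlongrightarrow> L) right_end"
    by (simp add: algebra_simps)
  have p: "p \<noteq> 0" using lim' \<open>L \<noteq> 0\<close> by (auto simp: tendsto_const_iff)
  have "(\<lambda>x. - ((h x - poly p x / poly q x) * (inverse (h x) * inverse (poly p x / poly q x)))) \<in>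
          Oinf (m + (j + j))"
    unfolding landau_o.big.uminus_in_iff
    using 1 inverse_Oinf[OF lim] inverse_Oinf[OF lim'] by (intro Oinf_mult) auto
  moreover have "eventually (\<lambda>x. - ((h x - poly p x / poly q x) * (inverse (h x) * inverse (poly p x / poly q x)))
      = inverse (h x) - poly q x / poly p x) right_end"
    using inverse_Oinf[OF lim, THEN conjunct2] inverse_Oinf[OF lim', THEN conjunct2]
    by eventually_elim (simp add: field_simps)
  ultimately have "(\<lambda>x. inverse (h x) - poly q x / poly p x) \<in> Oinf (m + (j + j))"
    by (subst (asm) landau_o.big.in_cong)
  then have "(\<lambda>x. inverse (h x) - poly q x / poly p x) \<in> Oinf k"
    by (rule Oinf_mono) (simp add: m_def)
  with p show "\<exists>p q. q \<noteq> 0 \<and> (\<lambda>x. inverse (h x) - poly p x / poly q x) \<in> Oinf k" by blast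
qed

text \<open>If \<open>f\<close> is not in \<open>Oinf m\<close>, an approximant with error in
  \<open>Oinf (m - 1)\<close> must have a leading term of order above \<open>m\<close>, for
  otherwise \<open>f\<close> would lie in \<open>Oinf m\<close>. The error is of lower order, so
  \<open>f\<close> inherits that leading term.\<close>

lemma rationally_approximable_cases:
  assumes "rationally_approximable f"
  obtains (leading) k L where "L \<noteq> 0" "((\<lambda>x. f x * x powi k) \<longlongrightarrow> L) right_end"
  | (flat) "\<And>k. f \<in> Oinf k"
proof (cases "\<forall>k. f \<in> Oinf k")
  case True
  then show ?thesis using flat by blast
next
  case False
  then obtain m where m: "f \<notin> Oinf m" by blast
  obtain p q where q: "q \<noteq> 0" and 1: "(\<lambda>x. f x - poly p x / poly q x) \<in> Oinf (m - 1)"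
    using assms(1) by (rule rationally_approximableE)
  have "p \<noteq> 0" using m Oinf_mono[OF 1, of m] by auto
  from rational_leading_term[OF this q] obtain k L where L: "L \<noteq> 0"
    and lim: "((\<lambda>x. poly p x / poly q x * x powi k) \<longlongrightarrow> L) right_end" by blast
  have "m < - k"
  proof (rule ccontr)
    assume "\<not> m < - k"
    then have "(\<lambda>x. (f x - poly p x / poly q x) + poly p x / poly q x) \<in> Oinf m"
      using 1 tendsto_powi_imp_Oinf[OF lim] by (intro sum_in_bigo(1)) (auto intro: Oinf_mono)
    with m show False by simp
  qed
  have "(\<lambda>x. (f x - poly p x / poly q x) * x powi k) \<in> Oinf (m - 1 + k)"
    using 1 by (intro Oinf_mult) auto
  then have "((\<lambda>x. (f x - poly p x / poly q x) * x powi k) \<longlongrightarrow> 0) right_end"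
    by (rule Oinf_neg_tendsto) (use \<open>m < - k\<close> in simp)
  from tendsto_add[OF this lim] have "((\<lambda>x. f x * x powi k) \<longlongrightarrow> L) right_end"
    by (simp add: algebra_simps)
  with L show ?thesis by (rule leading)
qed

section \<open>Factorial series\<close>

text \<open>Convergence at \<open>x\<close> gives only bounded terms. Passing to
  \<open>x + 2\<close> multiplies them by \<open>x (x + 1) / ((x + k) (x + k + 1))\<close>, which is
  summable over \<open>k\<close>.\<close>

lemma summable_factorial_series_norm:
  fixes a :: "nat \<Rightarrow> complex"
  assumes "summable (\<lambda>k. a k * inverse (pochhammer (complex_of_real x) k))" "x > 0"
  shows "summable (\<lambda>k. norm (a k) / pochhammer (x + 2) k)"
proof -
  have "Bseq (\<lambda>k. a k * inverse (pochhammer (complex_of_real x) k))"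
    using summable_LIMSEQ_zero[OF assms(1)] by (intro convergent_imp_Bseq convergentI)
  then obtain C where C: "C > 0" "\<And>k. norm (a k * inverse (pochhammer (complex_of_real x) k)) \<le> C"
    unfolding Bseq_def by blast
  have bound: "norm (norm (a k) / pochhammer (x + 2) k) \<le> C * (x * (x + 1)) * inverse (real k ^ 2)"
    if "k \<ge> 1" for k
  proof -
    have pos: "pochhammer x k > 0" "pochhammer (x + 2) k > 0"
      using assms(2) by (auto intro!: pochhammer_pos)
    have "pochhammer x k * ((x + k) * (x + k + 1)) = pochhammer x (Suc (Suc k))"
      by (simp add: pochhammer_Suc algebra_simps)
    also have "\<dots> = x * (x + 1) * pochhammer (x + 2) k"
      by (simp add: pochhammer_rec algebra_simps)
    finally have eq: "pochhammer x k * ((x + k) * (x + k + 1)) = x * (x + 1) * pochhammer (x + 2) k" .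
    have "norm (pochhammer (complex_of_real x) k) = pochhammer x k"
      using pos(1) by (simp add: pochhammer_of_real)
    with C(2)[of k] pos have "norm (a k) \<le> C * pochhammer x k"
      by (simp add: norm_mult norm_inverse norm_divide field_simps)
    then have "norm (a k) / pochhammer (x + 2) k \<le> C * (pochhammer x k / pochhammer (x + 2) k)"
      using pos by (simp add: divide_right_mono)
    also have "pochhammer x k / pochhammer (x + 2) k = x * (x + 1) / ((x + k) * (x + k + 1))"
    proof -
      have "(x + k) * (x + k + 1) \<noteq> 0" "pochhammer (x + 2) k \<noteq> 0"
        using assms(2) pos(2) by auto
      then show ?thesis using eq by (subst frac_eq_eq) assumption+
    qed
    also have "x * (x + 1) / ((x + k) * (x + k + 1)) \<le> x * (x + 1) / (real k ^ 2)"
      using assms(2) that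
      by (intro divide_left_mono) (auto simp: power2_eq_square intro!: mult_mono)
    finally show ?thesis using C(1) pos by (simp add: divide_simps)
  qed
  have "summable (\<lambda>k. C * (x * (x + 1)) * inverse (real k ^ 2))"
    by (intro summable_mult inverse_power_summable) simp
  then show ?thesis
    by (rule summable_comparison_test_ev[rotated])
       (use bound in \<open>auto simp: eventually_at_top_linorder intro!: exI[of _ 1]\<close>)
qed

lemma pochhammer_mono_real:
  fixes x y :: real
  assumes "0 \<le> x" "x \<le> y"
  shows "pochhammer x k \<le> pochhammer y k"
  unfolding pochhammer_prod using assms by (intro prod_mono) auto

lemma power_le_pochhammer:
  fixes x :: real
  assumes "0 \<le> x"
  shows "x ^ k \<le> pochhammer x k"
proof -
  have "(\<Prod>i = 0..<k. x) \<le> pochhammer x k"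
    unfolding pochhammer_prod using assms by (intro prod_mono) auto
  then show ?thesis by simp
qed

text \<open>The first \<open>K\<close> factors of \<open>pochhammer t (k + K)\<close> contribute at
  least \<open>t ^ K\<close>, and the others are larger than at a fixed \<open>y < t\<close>. So the
  tail at \<open>t\<close> is at most a constant times \<open>1 / t ^ K\<close> times the absolutely
  convergent tail at \<open>y\<close>.\<close>

lemma factorial_series_remainder:
  fixes a :: "nat \<Rightarrow> complex"
  assumes sums: "\<And>x. Re x > A \<Longrightarrow> (\<lambda>k. a k * inverse (pochhammer x k)) sums f x"
    and A: "A \<ge> 0"
  shows "(\<lambda>x. f x - (\<Sum>k<K. a k * inverse (pochhammer x k))) \<in> Oinf (- int K)"
proof -
  \<comment> \<open>\<open>A + 1\<close> is a point of convergence, and absolute convergence costs a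
    further shift by 2.\<close>
  define y where "y = A + 3"
  have y: "y > 0" using A by (simp add: y_def)
  have "summable (\<lambda>k. a k * inverse (pochhammer (complex_of_real (A + 1)) k))"
    using sums[of "complex_of_real (A + 1)"] by (simp add: sums_iff)
  from summable_factorial_series_norm[OF this] A
  have smb: "summable (\<lambda>k. norm (a k) / pochhammer y k)" by (simp add: y_def add.commute)
  define S where "S = (\<Sum>k. norm (a (k + K)) / pochhammer y (k + K))"
  have smb': "summable (\<lambda>k. norm (a (k + K)) / pochhammer y (k + K))"
    using smb by (rule summable_ignore_initial_segment)
  have "norm (f x - (\<Sum>k<K. a k * inverse (pochhammer x k))) \<le> S * pochhammer y K * norm (x powi (- int K))"
    if x: "x = complex_of_real t" "t > y" for x t
  proof -
    have t: "t > 0" using x y by simp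
    have norm_poch: "norm (pochhammer x k) = pochhammer t k" for k
      using t by (simp add: x pochhammer_of_real pochhammer_nonneg)
    have "(\<lambda>k. a (k + K) * inverse (pochhammer x (k + K))) sums
            (f x - (\<Sum>k<K. a k * inverse (pochhammer x k)))"
      using sums[of x] x by (intro sums_split_initial_segment) (simp add: y_def)
    moreover have le: "norm (a (k + K) * inverse (pochhammer x (k + K))) \<le>
        norm (a (k + K)) / pochhammer y (k + K) * (pochhammer y K * inverse (t ^ K))" for k
    proof -
      have pos: "pochhammer y K > 0" "pochhammer y (k + K) > 0" "pochhammer t (k + K) > 0"
        using y t by (auto intro!: pochhammer_pos)
      have "pochhammer y (k + K) * t ^ K = pochhammer y K * (t ^ K * pochhammer (y + real K) k)"
        by (simp add: pochhammer_product'[of y K k] add.commute[of k])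
      also have "\<dots> \<le> pochhammer y K * (pochhammer t K * pochhammer (t + real K) k)"
        using x y t pos
        by (intro mult_left_mono mult_mono power_le_pochhammer pochhammer_mono_real pochhammer_nonneg)
           auto
      also have "\<dots> = pochhammer y K * pochhammer t (k + K)"
        by (simp add: pochhammer_product'[of t K k] add.commute[of k])
      finally have "inverse (pochhammer t (k + K)) \<le>
          inverse (pochhammer y (k + K)) * (pochhammer y K * inverse (t ^ K))"
        using pos t by (simp add: field_simps)
      then show ?thesis
        by (simp add: norm_mult norm_inverse norm_poch divide_inverse mult.assoc mult_left_mono)
    qed
    ultimately have "norm (f x - (\<Sum>k<K. a k * inverse (pochhammer x k))) \<le>
        (\<Sum>k. norm (a (k + K)) / pochhammer y (k + K) * (pochhammer y K * inverse (t ^ K)))"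
      using norm_suminf_le[OF le summable_mult2[OF smb']] by (simp add: sums_iff)
    also have "\<dots> = S * (pochhammer y K * inverse (t ^ K))"
      unfolding S_def using smb' by (rule suminf_mult2[symmetric])
    finally show ?thesis using t by (simp add: x norm_inverse norm_power power_int_minus)
  qed
  then show ?thesis
    by (intro bigoI[of _ "S * pochhammer y K"] eventually_right_endI[of y]) blast
qed

lemma pochhammer_asymptotic:
  "((\<lambda>x::complex. inverse (pochhammer x k) * x powi (int k)) \<longlongrightarrow> 1) right_end"
proof (induction k)
  case (Suc k)
  have "((\<lambda>x::complex. inverse (1 + of_nat k * inverse x)) \<longlongrightarrow> inverse (1 + of_nat k * 0)) right_end"
    by (intro tendsto_intros tendsto_inverse_right_end) auto
  from tendsto_mult[OF Suc this]
  have "((\<lambda>x::complex. inverse (pochhammer x k) * x powi (int k) * inverse (1 + of_nat k * inverse x))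
    \<longlongrightarrow> 1) right_end" by simp
  moreover have "eventually (\<lambda>x::complex. inverse (pochhammer x k) * x powi (int k) *
      inverse (1 + of_nat k * inverse x) = inverse (pochhammer x (Suc k)) * x powi int (Suc k)) right_end"
  proof (rule eventually_right_endI[of 0])
    fix t :: real assume "t > 0"
    define x where "x = complex_of_real t"
    have "x \<noteq> 0" "x + of_nat k \<noteq> 0"
      using \<open>t > 0\<close> by (auto simp: x_def complex_eq_iff)
    moreover from this have "inverse (1 + of_nat k * inverse x) = inverse (x + of_nat k) * x"
      by (simp add: divide_simps)
    ultimately show "inverse (pochhammer x k) * x powi (int k) * inverse (1 + of_nat k * inverse x) =
        inverse (pochhammer x (Suc k)) * x powi int (Suc k)"
      by (simp add: pochhammer_Suc power_int_add)
  qed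
  ultimately show ?case by (rule Lim_transform_eventually)
qed simp

lemma rationally_approximable_inverse_pochhammer:
  "rationally_approximable (\<lambda>x. inverse (pochhammer x k))"
proof (induction k)
  case 0
  then show ?case using rationally_approximable_const[of 1] by simp
next
  case (Suc k)
  have "rationally_approximable (\<lambda>x. inverse (x + of_nat k))"
    unfolding rationally_approximable_def
    by (intro allI exI[of _ 1] exI[of _ "[:of_nat k, 1:]"]) (auto simp: field_simps)
  from rationally_approximable_mult[OF Suc this] show ?case
    by (simp add: pochhammer_Suc mult.commute)
qed

lemma rationally_approximable_trans:
  assumes "\<And>k. \<exists>g. rationally_approximable g \<and> (\<lambda>x. f x - g x) \<in> Oinf k"
  shows "rationally_approximable f"
  unfolding rationally_approximable_def
proof
  fix k
  from assms[of k] obtain g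
    where g: "rationally_approximable g" and 1: "(\<lambda>x. f x - g x) \<in> Oinf k" by blast
  obtain p q where q: "q \<noteq> 0" and 2: "(\<lambda>x. g x - poly p x / poly q x) \<in> Oinf k"
    using g by (rule rationally_approximableE)
  have "(\<lambda>x. f x - poly p x / poly q x) \<in> Oinf k"
    using sum_in_bigo(1)[OF 1 2] by simp
  with q show "\<exists>p q. q \<noteq> 0 \<and> (\<lambda>x. f x - poly p x / poly q x) \<in> Oinf k" by blast
qed

lemma rationally_approximable_O_fact:
  assumes "f \<in> O_fact"
  shows "rationally_approximable f"
proof (rule rationally_approximable_trans)
  fix m :: int
  from assms obtain a A where "A \<ge> 0"
    "\<And>x. Re x > A \<Longrightarrow> (\<lambda>k. a k * inverse (pochhammer x k)) sums f x"
    unfolding O_fact_def by blast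
  \<comment> \<open>For \<open>m \<ge> 0\<close> the sum is empty, and a remainder bound of order 0
    is already enough.\<close>
  then have "(\<lambda>x. f x - (\<Sum>k<nat (- m). a k * inverse (pochhammer x k))) \<in> Oinf (- int (nat (- m)))"
    by (intro factorial_series_remainder)
  then have "(\<lambda>x. f x - (\<Sum>k<nat (- m). a k * inverse (pochhammer x k))) \<in> Oinf m"
    by (rule Oinf_mono) simp
  moreover have "rationally_approximable (\<lambda>x. \<Sum>k<nat (- m). a k * inverse (pochhammer x k))"
    by (intro rationally_approximable_sum rationally_approximable_mult rationally_approximable_const
        rationally_approximable_inverse_pochhammer)
  ultimately show "\<exists>g. rationally_approximable g \<and> (\<lambda>x. f x - g x) \<in> Oinf m"
    by (intro exI[of _ "\<lambda>x. \<Sum>k<nat (- m). a k * inverse (pochhammer x k)"] conjI)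
qed

text \<open>The leading term is that of the first nonzero coefficient; if all coefficients vanished,
  so would \<open>f\<close> on a half-plane. This is what permits inverting the denominators in
  \<open>M_fact\<close>.\<close>

lemma O_fact_leading_term:
  assumes "f \<in> O_fact" "\<not> (\<exists>A. \<forall>x. Re x > A \<longrightarrow> f x = 0)"
  shows "\<exists>k L. L \<noteq> 0 \<and> ((\<lambda>x. f x * x powi k) \<longlongrightarrow> L) right_end"
proof -
  from assms obtain a A where A: "A \<ge> 0"
    and sums: "\<And>x. Re x > A \<Longrightarrow> (\<lambda>k. a k * inverse (pochhammer x k)) sums f x"
    unfolding O_fact_def by blast
  have "\<exists>k. a k \<noteq> 0"
  proof (rule ccontr)
    assume "\<not> ?thesis"
    then have "f x = 0" if "Re x > A" for x
      using sums[OF that] by (simp add: sums_iff)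
    with assms(2) show False by blast
  qed
  define k where "k = (LEAST k. a k \<noteq> 0)"
  have k: "a k \<noteq> 0" unfolding k_def by (rule LeastI_ex) fact
  have less: "a j = 0" if "j < k" for j using not_less_Least that unfolding k_def by blast
  have "(\<lambda>x. f x - a k * inverse (pochhammer x k)) \<in> Oinf (- int (Suc k))"
    using factorial_series_remainder[where K = "Suc k", OF sums A] less by simp
  then have "(\<lambda>x. (f x - a k * inverse (pochhammer x k)) * x powi (int k)) \<in> Oinf (- int (Suc k) + int k)"
    by (intro Oinf_mult) auto
  then have "((\<lambda>x. (f x - a k * inverse (pochhammer x k)) * x powi (int k)) \<longlongrightarrow> 0) right_end"
    by (rule Oinf_neg_tendsto) simp
  from tendsto_add[OF this tendsto_mult_left[OF pochhammer_asymptotic, of "a k" k]]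
  have "((\<lambda>x. f x * x powi (int k)) \<longlongrightarrow> a k) right_end"
    by (simp add: algebra_simps)
  with k show ?thesis by (intro exI conjI)
qed

lemma rationally_approximable_M_fact:
  assumes "f \<in> M_fact"
  shows "rationally_approximable f"
proof -
  from assms obtain g h A where g: "g \<in> O_fact" and h: "h \<in> O_fact"
      "\<not> (\<exists>A. \<forall>x. Re x > A \<longrightarrow> h x = 0)"
    and eq: "\<forall>\<^sub>\<approx>x\<in>{x. Re x > A}. f x = g x / h x"
    unfolding M_fact_def by blast
  from O_fact_leading_term[OF h] obtain k L
    where "L \<noteq> 0" "((\<lambda>x. h x * x powi k) \<longlongrightarrow> L) right_end" by blast
  then have "rationally_approximable (\<lambda>x. g x * inverse (h x))"
    by (intro rationally_approximable_mult rationally_approximable_inverse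
        rationally_approximable_O_fact g h)
  moreover have "eventually (\<lambda>x. g x * inverse (h x) = f x) right_end"
    unfolding eventually_right_end
  proof (intro exI conjI allI impI)
    \<comment> \<open>A sparse subset of the open half-plane is countable even if it accumulates at
      the boundary line, so \<open>right_end\<close> does not see it.\<close>
    show "countable ({x. Re x > A} \<inter> {x. f x \<noteq> g x / h x})"
      using eq unfolding eventually_cosparse
      by (intro sparse_imp_countable open_halfspace_Re_gt) auto
  qed (auto simp: field_simps)
  ultimately show ?thesis by (rule rationally_approximable_cong[rotated])
qed

section \<open>Scalar first order difference equations\<close>

text \<open>If \<open>z \<noteq> 0\<close>, the increments of \<open>Re (v m / z)\<close> are
  eventually at least \<open>1 / (2 m)\<close>, so their sum diverges like the harmonic series,
  whereas convergence of \<open>v\<close> makes the telescoping sum converge.\<close>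

lemma limit_of_scaled_increments_zero:
  fixes v :: "nat \<Rightarrow> complex"
  assumes "convergent v" and lim: "(\<lambda>m. of_nat m * (v (Suc m) - v m)) \<longlonglongrightarrow> z"
  shows "z = 0"
proof (rule ccontr)
  assume z: "z \<noteq> 0"
  define w where "w m = Re (v m / z)" for m
  from assms(1) obtain l where "v \<longlonglongrightarrow> l" by (auto simp: convergent_def)
  then have "w \<longlonglongrightarrow> Re (l / z)" unfolding w_def using z by (intro tendsto_intros)
  from telescope_summable[OF this] have smb: "summable (\<lambda>m. w (Suc m) - w m)" .
  have "(\<lambda>m. Re (of_nat m * (v (Suc m) - v m) / z)) \<longlonglongrightarrow> Re (z / z)"
    using z by (intro tendsto_intros lim)
  also have "(\<lambda>m. Re (of_nat m * (v (Suc m) - v m) / z)) = (\<lambda>m. real m * (w (Suc m) - w m))"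
  proof
    fix m
    have "of_nat m * (v (Suc m) - v m) / z = of_real (real m) * (v (Suc m) / z - v m / z)"
      by (simp add: diff_divide_distrib algebra_simps)
    then show "Re (of_nat m * (v (Suc m) - v m) / z) = real m * (w (Suc m) - w m)"
      by (simp only: w_def Re_complex_of_real times_complex.sel minus_complex.sel Im_complex_of_real
          mult_zero_left diff_zero)
  qed
  finally have "(\<lambda>m. real m * (w (Suc m) - w m)) \<longlonglongrightarrow> 1" using z by simp
  then have "eventually (\<lambda>m. real m * (w (Suc m) - w m) > 1 / 2) sequentially"
    by (rule order_tendstoD) simp
  then have "eventually (\<lambda>m. norm (1 / 2 * (1 / real m)) \<le> w (Suc m) - w m) sequentially"
    using eventually_gt_at_top[of 0] by eventually_elim (simp add: field_simps)
  from summable_comparison_test_ev[OF this smb] have "summable (\<lambda>m. 1 / 2 * (1 / real m))" .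
  then have "summable (\<lambda>m. inverse (real m))"
    unfolding summable_cmult_iff by (simp add: inverse_eq_divide)
  then show False using not_summable_harmonic[where ?'a = real] by (simp add: inverse_eq_divide)
qed

text \<open>The equation of a single entry of \<open>P\<close> after multiplication by
  \<open>x - 1\<close>: \<open>d\<close> and \<open>d'\<close> are diagonal entries of
  \<open>D\<close> and \<open>D'\<close>, and \<open>r\<close> collects neighbouring entries already
  known to be constant.\<close>

definition first_order_recurrence ::
    "complex \<Rightarrow> complex \<Rightarrow> complex \<Rightarrow> (complex \<Rightarrow> complex) \<Rightarrow> bool" where
  "first_order_recurrence d d' r f \<longleftrightarrow>
     eventually (\<lambda>x. f (x - 1) * (x - 1 - d') = (x - 1 - d) * f x + r) cocountable"

text \<open>The recurrence is expanded at infinity to first order in \<open>1/x\<close>. The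
  inhomogeneous term contributes about \<open>r * x powi k\<close>, which for
  \<open>r \<noteq> 0\<close> stays bounded only if \<open>k \<le> 0\<close>; hence the assumption
  linking \<open>k\<close> and \<open>r\<close>.\<close>

lemma recurrence_increment_limit:
  assumes rec: "first_order_recurrence d d' r f"
    and lim: "((\<lambda>x. f x * x powi k) \<longlongrightarrow> L) right_end"
    and k: "k \<le> 0 \<or> r = 0"
  shows "((\<lambda>x. x * (f (x - 1) * (x - 1) powi k - f x * x powi k))
           \<longlongrightarrow> (of_int (- k) + d' - d) * L + (if k = 0 then r else 0)) right_end"
proof -
  \<comment> \<open>In the homogeneous case \<open>g (1/x)\<close> is the factor that turns
    \<open>f x * x powi k\<close> into \<open>f (x - 1) * (x - 1) powi k\<close>; its derivative at
    0 is the coefficient of \<open>1/x\<close> in that factor.\<close>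
  define g where "g u = (1 - u) powi k * ((1 - u - d * u) / (1 - u - d' * u))" for u :: complex
  have "((\<lambda>u::complex. 1 - u) has_field_derivative - 1) (at 0)"
    by (auto intro!: derivative_eq_intros)
  from DERIV_power_int[OF this, of k]
  have "((\<lambda>u::complex. (1 - u) powi k) has_field_derivative of_int k * (1 - 0) powi (k - 1) * - 1) (at 0)"
    by simp
  moreover have "((\<lambda>u::complex. (1 - u - d * u) / (1 - u - d' * u)) has_field_derivative (d' - d)) (at 0)"
    by (rule derivative_eq_intros refl | simp)+
  ultimately have "(g has_field_derivative
      of_int k * (1 - 0) powi (k - 1) * - 1 * ((1 - 0 - d * 0) / (1 - 0 - d' * 0)) +
      (d' - d) * (1 - 0) powi k) (at 0)"
    unfolding g_def by (rule DERIV_mult)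
  then have "(g has_field_derivative (of_int (- k) + d' - d)) (at 0)"
    by (simp add: algebra_simps)
  then have "((\<lambda>u. (g u - 1) / u) \<longlongrightarrow> (of_int (- k) + d' - d)) (at 0)"
    by (simp add: DERIV_def g_def)
  moreover have "filterlim (\<lambda>x::complex. inverse x) (at 0) right_end"
    unfolding filterlim_inverse_at_iff by (simp add: filterlim_def right_end_le_at_infinity)
  ultimately have g: "((\<lambda>x. (g (inverse x) - 1) / inverse x) \<longlongrightarrow> (of_int (- k) + d' - d)) right_end"
    by (rule filterlim_compose)
  have shift_ne: "eventually (\<lambda>x. x - a \<noteq> 0) right_end" for a
    by (rule eventually_cocountable_imp_right_end) (simp add: eventually_cocountable)
  have r: "((\<lambda>x. r * (inverse (1 - (1 + d') * inverse x) * ((1 - inverse x) powi k * x powi k)))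
      \<longlongrightarrow> (if k = 0 then r else 0)) right_end"
  proof (cases "r = 0 \<or> k = 0")
    case True
    have "((\<lambda>x. r * (inverse (1 - (1 + d') * inverse x)))
      \<longlongrightarrow> r * inverse (1 - (1 + d') * 0)) right_end"
      by (intro tendsto_intros tendsto_inverse_right_end) simp
    with True show ?thesis by auto
  next
    case False
    with k have "k < 0" by simp
    have "((\<lambda>x. r * (inverse (1 - (1 + d') * inverse x) * ((1 - inverse x) powi k * x powi k)))
      \<longlongrightarrow> r * (inverse (1 - (1 + d') * 0) * ((1 - 0) powi k * 0))) right_end"
      by (intro tendsto_intros tendsto_inverse_right_end tendsto_powi_neg \<open>k < 0\<close>) simp_all
    with False show ?thesis by simp
  qed
  have "((\<lambda>x. (g (inverse x) - 1) / inverse x * (f x * x powi k) +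
        r * (inverse (1 - (1 + d') * inverse x) * ((1 - inverse x) powi k * x powi k)))
     \<longlongrightarrow> (of_int (- k) + d' - d) * L + (if k = 0 then r else 0)) right_end"
    by (intro tendsto_add tendsto_mult g lim r)
  moreover have "eventually (\<lambda>x. (g (inverse x) - 1) / inverse x * (f x * x powi k) +
        r * (inverse (1 - (1 + d') * inverse x) * ((1 - inverse x) powi k * x powi k)) =
      x * (f (x - 1) * (x - 1) powi k - f x * x powi k)) right_end"
    using shift_ne[of 0] shift_ne[of 1] shift_ne[of "1 + d'"]
      eventually_cocountable_imp_right_end[OF rec[unfolded first_order_recurrence_def]]
  proof eventually_elim
    case (elim x)
    have 1: "(1 - inverse x) powi k * x powi k = (x - 1) powi k"
    proof -
      have "(1 - inverse x) * x = x - 1" using elim(1) by (simp add: left_diff_distrib)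
      then show ?thesis by (simp only: power_int_mult_distrib[symmetric])
    qed
    have 2: "inverse (1 - (1 + d') * inverse x) = x / (x - 1 - d')"
      using elim by (simp add: divide_simps) (simp add: algebra_simps)
    have 3: "(1 - inverse x - d * inverse x) / (1 - inverse x - d' * inverse x) = (x - 1 - d) / (x - 1 - d')"
    proof -
      have "1 - inverse x - c * inverse x = (x - 1 - c) / x" for c
        using elim(1) by (simp add: field_simps)
      then show ?thesis using elim(1) by simp
    qed
    have f: "f (x - 1) = ((x - 1 - d) * f x + r) / (x - 1 - d')"
      using elim by (simp add: eq_divide_eq diff_diff_eq)
    have alg: "(A * Q - 1) / inverse x * (F * W) = x * (A * W) * (Q * F) - x * (F * W)"
      for A Q F W :: complex using elim(1) by (simp add: field_simps)
    have "(g (inverse x) - 1) / inverse x * (f x * x powi k) =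
       x * ((1 - inverse x) powi k * x powi k) * ((x - 1 - d) / (x - 1 - d') * f x) - x * (f x * x powi k)"
      unfolding g_def 3 by (rule alg)
    also have "\<dots> = x * (x - 1) powi k * ((x - 1 - d) / (x - 1 - d') * f x) - x * (f x * x powi k)"
      by (simp only: 1)
    finally have lead: "(g (inverse x) - 1) / inverse x * (f x * x powi k) =
      x * (x - 1) powi k * ((x - 1 - d) / (x - 1 - d') * f x) - x * (f x * x powi k)" .
    have alg': "x * V * (a / e * F) - x * (F * W) + r * (x / e * V) = x * ((a * F + r) / e * V - F * W)"
      for V W a e F :: complex by (simp add: add_divide_distrib algebra_simps)
    show ?case unfolding lead 1 2 f by (rule alg')
  qed
  ultimately show ?thesis by (rule Lim_transform_eventually)
qed

text \<open>Along generic \<open>t, t + 1, ...\<close> the function \<open>f x * x powi k\<close>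
  converges, and so do its increments multiplied by the index; by
  \<open>limit_of_scaled_increments_zero\<close> the second limit is 0.\<close>

lemma recurrence_leading_term:
  assumes rec: "first_order_recurrence d d' r f"
    and lim: "((\<lambda>x. f x * x powi k) \<longlongrightarrow> L) right_end"
    and k: "k \<le> 0 \<or> r = 0"
  shows "(of_int (- k) + d' - d) * L + (if k = 0 then r else 0) = 0" (is "?z = 0")
proof -
  define v where "v x = f x * x powi k" for x
  obtain Z1 where Z1: "countable Z1"
    "\<And>t. (\<And>m::nat. complex_of_real t + of_nat m \<notin> Z1) \<Longrightarrow>
        (\<lambda>m. v (complex_of_real t + of_nat m)) \<longlonglongrightarrow> L"
    using tendsto_right_end_generic[OF lim] unfolding v_def by blast
  obtain Z2 where Z2: "countable Z2"
    "\<And>t. (\<And>m::nat. complex_of_real t + of_nat m \<notin> Z2) \<Longrightarrow>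
        (\<lambda>m. (\<lambda>x. x * (v (x - 1) - v x)) (complex_of_real t + of_nat m)) \<longlonglongrightarrow> ?z"
    using tendsto_right_end_generic[OF recurrence_increment_limit[OF assms]] unfolding v_def by blast
  have "eventually (\<lambda>x. x \<notin> Z1 \<and> x \<notin> Z2) cocountable"
    using countable_Un[OF Z1(1) Z2(1)] by (simp add: eventually_cocountable Un_def)
  then obtain t where t: "t > 0" "\<And>m::nat. complex_of_real t + of_nat m \<notin> Z1"
      "\<And>m::nat. complex_of_real t + of_nat m \<notin> Z2"
    by (rule ex_generic_real[where X = 0]) blast
  define y where "y m = complex_of_real t + of_nat m" for m :: nat
  have conv: "convergent (\<lambda>m. v (y m))"
    using Z1(2)[OF t(2)] by (auto simp: y_def convergent_def)
  have "(\<lambda>m. y (Suc m) * (v (y (Suc m) - 1) - v (y (Suc m)))) \<longlonglongrightarrow> ?z"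
    using Z2(2)[OF t(3)] unfolding y_def by (rule LIMSEQ_Suc)
  \<comment> \<open>The quotient \<open>m / y (Suc m)\<close> tends to 1 and exchanges the weight
    \<open>y (Suc m)\<close> for \<open>m\<close>; the sign changes because the recurrence steps
    downwards.\<close>
  then have "(\<lambda>m. - (of_nat m / y (Suc m)) * (y (Suc m) * (v (y m) - v (y (Suc m))))) \<longlonglongrightarrow> - 1 * ?z"
  proof (intro tendsto_mult tendsto_minus)
    have "(\<lambda>m. real m / (t + real (Suc m))) \<longlonglongrightarrow> 1" by real_asymp
    from tendsto_of_real[OF this, where ?'a = complex]
    show "(\<lambda>m. of_nat m / y (Suc m)) \<longlonglongrightarrow> 1" by (simp add: y_def)
  qed (simp add: y_def)
  moreover have "- (of_nat m / y (Suc m)) * (y (Suc m) * (v (y m) - v (y (Suc m)))) =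
      of_nat m * (v (y (Suc m)) - v (y m))" for m
  proof -
    have "y (Suc m) \<noteq> 0" using t(1) by (auto simp: y_def complex_eq_iff)
    then show ?thesis by (simp add: field_simps)
  qed
  ultimately have "(\<lambda>m. of_nat m * (v (y (Suc m)) - v (y m))) \<longlonglongrightarrow> - 1 * ?z" by simp
  from limit_of_scaled_increments_zero[OF conv this] show ?thesis by (simp only: minus_mult_left[symmetric] mult_1_left neg_equal_0_iff_equal)
qed

text \<open>With \<open>s = x - 1\<close>, the factor \<open>(x - 1 - d) / (x - 1 - d')\<close> has
  modulus at most \<open>1 + K / s\<close>, which Bernoulli's inequality bounds by
  \<open>(1 + 1 / s) ^ K = (x / (x - 1)) ^ K\<close>. The quantifier over \<open>f\<close> stands
  inside, so the threshold does not depend on \<open>f\<close>.\<close>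

lemma flat_recurrence_growth:
  assumes "real K \<ge> 2 * norm (d' - d)"
  shows "eventually (\<lambda>x. \<forall>f. f (x - 1) * (x - 1 - d') = (x - 1 - d) * f x \<longrightarrow>
           norm (f (x - 1) * (x - 1) ^ K) \<le> norm (f x * x ^ K)) right_end"
proof (rule eventually_right_endI[of "1 + 2 * norm d'"], intro allI impI)
  fix t f assume t: "t > 1 + 2 * norm d'" and f:
    "f (complex_of_real t - 1) * (complex_of_real t - 1 - d') = (complex_of_real t - 1 - d) * f (complex_of_real t)"
  define x where "x = complex_of_real t"
  define s where "s = t - 1"
  have s: "s > 0" "s > 2 * norm d'" unfolding s_def using t norm_ge_zero[of d'] by linarith+
  have x1: "x - 1 = of_real s" by (simp add: x_def s_def)
  \<comment> \<open>The threshold \<open>1 + 2 * norm d'\<close> keeps at least half of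
    \<open>s\<close>; the factor 2 in the bound on \<open>K\<close> makes up for the other
    half.\<close>
  have den: "norm (x - 1 - d') \<ge> s / 2"
    using norm_triangle_ineq2[of "x - 1" d'] s unfolding x1 by simp
  have "norm (f (x - 1)) * norm (x - 1 - d') = norm (x - 1 - d) * norm (f x)"
    using f by (metis norm_mult x_def)
  also have "\<dots> \<le> (norm (x - 1 - d') + norm (d' - d)) * norm (f x)"
    using norm_triangle_ineq[of "x - 1 - d'" "d' - d", unfolded diff_add_cancel add_diff_eq] by (intro mult_right_mono) simp_all
  also have "norm (d' - d) \<le> real K / s * (s / 2)" using s assms by simp
  also have "\<dots> \<le> real K / s * norm (x - 1 - d')"
    using den s by (intro mult_left_mono) auto
  finally have "norm (f (x - 1)) * norm (x - 1 - d') \<le>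
      ((1 + real K / s) * norm (f x)) * norm (x - 1 - d')"
    by (simp add: algebra_simps mult_right_mono)
  then have "norm (f (x - 1)) \<le> (1 + real K / s) * norm (f x)"
    by (rule mult_right_le_imp_le) (use den s in linarith)
  also have "1 + real K / s \<le> (1 + 1 / s) ^ K"
    using Bernoulli_inequality[of "1 / s" K] order_trans[of "- 1" 0 "1 / s"] s by simp
  finally have "norm (f (x - 1)) * s ^ K \<le> ((1 + 1 / s) ^ K * norm (f x)) * s ^ K"
    using s by (simp add: mult_right_mono)
  also have "\<dots> = norm (f x) * ((1 + 1 / s) * s) ^ K" by (simp add: power_mult_distrib)
  also have "(1 + 1 / s) * s = t" using s by (simp add: field_simps s_def)
  finally have "norm (f (x - 1)) * s ^ K \<le> norm (f x) * t ^ K" .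
  moreover have "norm (x - 1) = s" using s(1) unfolding x1 by simp
  moreover have "norm x = t" using s(1) by (simp add: x_def s_def)
  ultimately have "norm (f (x - 1) * (x - 1) ^ K) \<le> norm (f x * x ^ K)"
    by (simp only: norm_mult norm_power)
  then show "norm (f (of_real t - 1) * (of_real t - 1) ^ K) \<le> norm (f (of_real t) * of_real t ^ K)"
    unfolding x_def .
qed

text \<open>The function \<open>f x * x ^ K\<close> tends to 0, but its modulus does not decrease
  along \<open>t, t + 1, ...\<close>; hence it vanishes at every large generic
  \<open>t\<close>.\<close>

lemma flat_recurrence_zero:
  assumes rec: "first_order_recurrence d d' 0 f"
    and flat: "\<And>k. f \<in> Oinf k"
    and mero: "f meromorphic_on UNIV"
  shows "eventually (\<lambda>x. f x = 0) (cosparse UNIV)"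
proof -
  define K where "K = nat \<lceil>2 * norm (d' - d)\<rceil>"
  have K: "real K \<ge> 2 * norm (d' - d)" unfolding K_def by linarith
  define w where "w x = f x * x ^ K" for x
  have "w \<in> Oinf (- int (Suc K) + int K)"
    unfolding w_def using Oinf_mult[OF flat[of "- int (Suc K)"] Oinf_mono_fun[of "int K" "int K"]] by simp
  then have "(w \<longlongrightarrow> 0) right_end" by (rule Oinf_neg_tendsto) simp
  then obtain Z1 where Z1: "countable Z1"
    "\<And>t. (\<And>m::nat. complex_of_real t + of_nat m \<notin> Z1) \<Longrightarrow>
        (\<lambda>m. w (complex_of_real t + of_nat m)) \<longlonglongrightarrow> 0"
    using tendsto_right_end_generic by blast
  have "eventually (\<lambda>x. norm (w (x - 1)) \<le> norm (w x)) right_end"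
    using flat_recurrence_growth[OF K] eventually_cocountable_imp_right_end[OF rec[unfolded first_order_recurrence_def]]
    by eventually_elim (simp add: w_def)
  then obtain X Z2 where Z2: "countable Z2"
    "\<And>t. t > X \<Longrightarrow> complex_of_real t \<notin> Z2 \<Longrightarrow> norm (w (complex_of_real t - 1)) \<le> norm (w (complex_of_real t))"
    unfolding eventually_right_end by blast
  show ?thesis
  proof (rule ccontr)
    assume "\<not> ?thesis"
    \<comment> \<open>A meromorphic function on the plane is zero off a sparse set or nonzero off a
      sparse set; in the second case a generic \<open>t\<close> has
      \<open>f t \<noteq> 0\<close>.\<close>
    with meromorphic_imp_constant_or_avoid[OF mero open_UNIV connected_UNIV, of 0]
    have "eventually (\<lambda>x. f x \<noteq> 0) (cosparse UNIV)" by blast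
    then have "eventually (\<lambda>x. f x \<noteq> 0) cocountable" by (rule eventually_cosparse_imp_cocountable)
    moreover have "eventually (\<lambda>x. x \<notin> Z1 \<and> x \<notin> Z2) cocountable"
      using countable_Un[OF Z1(1) Z2(1)] by (simp add: eventually_cocountable Un_def)
    ultimately have "eventually (\<lambda>x. f x \<noteq> 0 \<and> x \<notin> Z1 \<and> x \<notin> Z2) cocountable"
      by (rule eventually_conj)
    then obtain t where t: "t > max X 0" "\<And>m::nat. f (complex_of_real t + of_nat m) \<noteq> 0"
        "\<And>m::nat. complex_of_real t + of_nat m \<notin> Z1" "\<And>m::nat. complex_of_real t + of_nat m \<notin> Z2"
      by (rule ex_generic_real[where X = "max X 0"]) blast
    define u where "u m = norm (w (complex_of_real t + of_nat m))" for m :: nat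
    have "u \<longlonglongrightarrow> 0" unfolding u_def using tendsto_norm[OF Z1(2)[OF t(3)]] by simp
    moreover have "incseq u"
    proof (rule incseq_SucI)
      fix m
      show "u m \<le> u (Suc m)"
        using Z2(2)[of "t + real (Suc m)"] t(1) t(4)[of "Suc m"] by (simp add: u_def add_ac)
    qed
    ultimately have "u 0 \<le> 0" by (intro incseq_le)
    then show False using t(1) t(2)[of 0] by (simp add: u_def w_def)
  qed
qed

lemma recurrence_constant:
  assumes rec: "first_order_recurrence d d' r f"
    and approx: "rationally_approximable f"
    and mero: "f meromorphic_on UNIV"
    and nonres: "\<And>k::int. d' - d = of_int k \<Longrightarrow> k = 0"
  shows "\<exists>c. eventually (\<lambda>x. f x = c) (cosparse UNIV)"
proof -
  have nz: "of_int (- k) + d' - d \<noteq> 0" if "k \<noteq> 0" for k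
    using nonres[of k] that by (auto simp: algebra_simps)
  \<comment> \<open>Growth, that is \<open>k < 0\<close>, would force
    \<open>of_int (- k) + d' - d = 0\<close>; all other cases give a finite limit.\<close>
  have "\<exists>c. (f \<longlongrightarrow> c) right_end"
    using approx
  proof (cases rule: rationally_approximable_cases)
    case (leading k L)
    consider "k < 0" | "k = 0" | "k > 0" by linarith
    then show ?thesis
    proof cases
      case 1
      with recurrence_leading_term[OF rec leading(2)] have "(of_int (- k) + d' - d) * L = 0" by simp
      with nz[of k] 1 leading(1) show ?thesis by simp
    next
      case 2
      with leading(2) show ?thesis by auto
    next
      case 3
      then show ?thesis using Oinf_neg_tendsto[OF tendsto_powi_imp_Oinf[OF leading(2)]] by auto
    qed
  next
    case flat
    then have "(f \<longlongrightarrow> 0) right_end" by (rule Oinf_neg_tendsto[where k = "-1"]) simp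
    then show ?thesis by (rule exI)
  qed
  then obtain c where c: "(f \<longlongrightarrow> c) right_end" by blast
  \<comment> \<open>This relation says exactly that the constant \<open>c\<close> solves the
    recurrence, so \<open>f - c\<close> solves the homogeneous one.\<close>
  have c_eq: "(d' - d) * c + r = 0"
    using recurrence_leading_term[OF rec, of 0 c] c by simp
  define g where "g x = f x - c" for x
  have g_rec: "first_order_recurrence d d' 0 g"
    using rec unfolding first_order_recurrence_def
  proof eventually_elim
    case (elim x)
    have "g (x - 1) * (x - 1 - d') - (x - 1 - d) * g x = (d' - d) * c + r"
      using elim unfolding g_def by (simp add: algebra_simps)
    with c_eq show ?case by simp
  qed
  have g_lim: "(g \<longlongrightarrow> 0) right_end"
    using tendsto_diff[OF c tendsto_const[of c]] by (simp add: g_def[abs_def])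
  have "rationally_approximable g"
    using rationally_approximable_add[OF approx rationally_approximable_const[of "- c"]]
    by (simp add: g_def[abs_def])
  then have "\<forall>k. g \<in> Oinf k"
  proof (cases rule: rationally_approximable_cases)
    case (leading k L)
    \<comment> \<open>Nonresonance leaves only \<open>k = 0\<close>, but then the nonzero
      \<open>L\<close> would be the limit of \<open>g\<close>, which is 0.\<close>
    from recurrence_leading_term[OF g_rec leading(2)] leading(1) nz[of k] have "k = 0" by auto
    with leading(2) have "(g \<longlongrightarrow> L) right_end" by simp
    with g_lim leading(1) show ?thesis using tendsto_unique[OF right_end_nontrivial] by blast
  qed blast
  moreover have "g meromorphic_on UNIV" unfolding g_def by (intro meromorphic_intros mero)
  ultimately have "eventually (\<lambda>x. g x = 0) (cosparse UNIV)"
    using flat_recurrence_zero[OF g_rec] by blast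
  then show ?thesis unfolding g_def by auto
qed

section \<open>Block diagonal Toeplitz matrices\<close>

text \<open>\<open>f k c\<close> is the entry on superdiagonal \<open>k\<close> of a block with
  parameter \<open>c\<close>. This one shape covers \<open>N\<close>, the Jordan matrix
  \<open>D\<close>, the matrix \<open>I - D/(x-1)\<close>, and the diagonal and nilpotent parts of
  \<open>D\<close>.\<close>

definition block_toeplitz ::
    "(nat \<Rightarrow> complex \<Rightarrow> complex) \<Rightarrow> (complex \<times> nat) list \<Rightarrow> complex mat" where
  "block_toeplitz f bs =
     diag_block_mat (map (\<lambda>(c, \<mu>). mat \<mu> \<mu> (\<lambda>(i, j). if i \<le> j then f (j - i) c else 0)) bs)"

abbreviation total_size :: "(complex \<times> nat) list \<Rightarrow> nat" where
  "total_size bs \<equiv> sum_list (map snd bs)"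

lemma block_toeplitz_dim [simp]:
  "dim_row (block_toeplitz f bs) = total_size bs"
  "dim_col (block_toeplitz f bs) = total_size bs"
  unfolding block_toeplitz_def dim_diag_block_mat
  by (auto intro!: arg_cong[where f = sum_list] simp: case_prod_unfold)

lemma block_toeplitz_carrier: "block_toeplitz f bs \<in> carrier_mat (total_size bs) (total_size bs)"
  by (rule carrier_matI) simp_all

lemma block_toeplitz_Cons:
  "block_toeplitz f ((c, \<mu>) # bs) =
     four_block_mat (mat \<mu> \<mu> (\<lambda>(i, j). if i \<le> j then f (j - i) c else 0))
       (0\<^sub>m \<mu> (total_size bs)) (0\<^sub>m (total_size bs) \<mu>) (block_toeplitz f bs)"
  using block_toeplitz_dim[of f bs] by (simp add: block_toeplitz_def Let_def)

text \<open>\<open>c i\<close> is the parameter of the block containing row \<open>i\<close>, and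
  \<open>same\<close> means lying in one block. Both are obtained before \<open>f\<close> is chosen,
  so all coefficient functions share one layout.\<close>

lemma block_toeplitz_index:
  obtains c :: "nat \<Rightarrow> complex" and same :: "nat \<Rightarrow> nat \<Rightarrow> bool" where
    "\<And>i. i < total_size bs \<Longrightarrow> c i \<in> fst ` set bs"
    "\<And>i. i < total_size bs \<Longrightarrow> same i i"
    "\<And>i j. i < total_size bs \<Longrightarrow> j < total_size bs \<Longrightarrow> same i j \<Longrightarrow> c i = c j"
    "\<And>f i j. i < total_size bs \<Longrightarrow> j < total_size bs \<Longrightarrow>
       block_toeplitz f bs $$ (i, j) = (if i \<le> j \<and> same i j then f (j - i) (c i) else 0)"
proof -
  have "\<exists>c same. (\<forall>i<total_size bs. c i \<in> fst ` set bs) \<and> (\<forall>i<total_size bs. same i i) \<and>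
    (\<forall>i<total_size bs. \<forall>j<total_size bs. same i j \<longrightarrow> c i = c j) \<and>
    (\<forall>f. \<forall>i<total_size bs. \<forall>j<total_size bs.
       block_toeplitz f bs $$ (i, j) = (if i \<le> j \<and> same i j then f (j - i) (c i) else 0))"
  proof (induction bs)
    case (Cons b bs)
    obtain d \<mu> where b: "b = (d, \<mu>)" by (cases b)
    from Cons obtain c same where IH: "\<forall>i<total_size bs. c i \<in> fst ` set bs"
      "\<forall>i<total_size bs. same i i"
      "\<forall>i<total_size bs. \<forall>j<total_size bs. same i j \<longrightarrow> c i = c j"
      "\<forall>f. \<forall>i<total_size bs. \<forall>j<total_size bs.
       block_toeplitz f bs $$ (i, j) = (if i \<le> j \<and> same i j then f (j - i) (c i) else 0)" by blast
    define c' where "c' i = (if i < \<mu> then d else c (i - \<mu>))" for i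
    define same' where "same' i j \<longleftrightarrow> i < \<mu> \<and> j < \<mu> \<or> i \<ge> \<mu> \<and> j \<ge> \<mu> \<and> same (i - \<mu>) (j - \<mu>)" for i j
    show ?case
    proof (intro exI[of _ c'] exI[of _ same'] conjI allI impI)
      fix i assume i: "i < total_size (b # bs)"
      show "c' i \<in> fst ` set (b # bs)"
      proof (cases "i < \<mu>")
        case False
        then have "c (i - \<mu>) \<in> fst ` set bs" using IH(1) i b by auto
        with False show ?thesis by (auto simp: c'_def)
      qed (simp add: c'_def b)
      show "same' i i" using IH(2) i b by (auto simp: same'_def)
      fix j assume j: "j < total_size (b # bs)"
      show "c' i = c' j" if "same' i j"
        using that IH(3) i j b by (auto simp: same'_def c'_def)
      fix f
      show "block_toeplitz f (b # bs) $$ (i, j) =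
          (if i \<le> j \<and> same' i j then f (j - i) (c' i) else 0)"
        using i j IH(4) unfolding b block_toeplitz_Cons
        by (auto simp: same'_def c'_def)
    qed
  qed simp
  then show ?thesis by (elim exE conjE) (rule that; blast)
qed

text \<open>Within a block, Toeplitz matrices are polynomials in one nilpotent shift, so multiplying
  them means taking the Cauchy product of coefficients.\<close>

lemma block_toeplitz_mult:
  "block_toeplitz f bs * block_toeplitz g bs =
     block_toeplitz (\<lambda>k c. \<Sum>i\<le>k. f i c * g (k - i) c) bs"
proof (induction bs)
  case (Cons b bs)
  obtain c \<mu> where b: "b = (c, \<mu>)" by (cases b)
  define T where "T f = mat \<mu> \<mu> (\<lambda>(i, j). if i \<le> j then f (j - i) c else 0)"
    for f :: "nat \<Rightarrow> complex \<Rightarrow> complex"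
  have T [simp]: "T f \<in> carrier_mat \<mu> \<mu>" for f by (simp add: T_def)
  have TT: "T f * T g = T (\<lambda>k c. \<Sum>i\<le>k. f i c * g (k - i) c)"
  proof (rule eq_matI)
    fix i j assume "i < dim_row (T (\<lambda>k c. \<Sum>i\<le>k. f i c * g (k - i) c))"
      "j < dim_col (T (\<lambda>k c. \<Sum>i\<le>k. f i c * g (k - i) c))"
    then have ij: "i < \<mu>" "j < \<mu>" by (auto simp: T_def)
    have "(T f * T g) $$ (i, j) =
        (\<Sum>l = 0..<\<mu>. (if i \<le> l then f (l - i) c else 0) * (if l \<le> j then g (j - l) c else 0))"
      using ij by (simp add: T_def scalar_prod_def)
    also have "\<dots> = (\<Sum>l = i..j. f (l - i) c * g (j - l) c)"
      using ij by (intro sum.mono_neutral_cong_right) auto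
    also have "\<dots> = (if i \<le> j then \<Sum>k\<le>j - i. f k c * g (j - i - k) c else 0)"
    proof (cases "i \<le> j")
      case True
      have "(\<Sum>l = i..j. f (l - i) c * g (j - l) c) = (\<Sum>k\<le>j - i. f k c * g (j - i - k) c)"
        by (rule sum.reindex_bij_witness[of _ "\<lambda>k. k + i" "\<lambda>l. l - i"]) (use True in auto)
      with True show ?thesis by simp
    qed simp
    finally show "(T f * T g) $$ (i, j) = T (\<lambda>k c. \<Sum>i\<le>k. f i c * g (k - i) c) $$ (i, j)"
      using ij by (simp add: T_def)
  qed (simp_all add: T_def)
  have "block_toeplitz f (b # bs) * block_toeplitz g (b # bs) =
     four_block_mat (T f) (0\<^sub>m \<mu> (total_size bs)) (0\<^sub>m (total_size bs) \<mu>) (block_toeplitz f bs) *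
     four_block_mat (T g) (0\<^sub>m \<mu> (total_size bs)) (0\<^sub>m (total_size bs) \<mu>) (block_toeplitz g bs)"
    unfolding b block_toeplitz_Cons T_def ..
  also have "\<dots> = four_block_mat (T f * T g) (0\<^sub>m \<mu> (total_size bs)) (0\<^sub>m (total_size bs) \<mu>)
      (block_toeplitz f bs * block_toeplitz g bs)"
    using T[of f] T[of g] block_toeplitz_carrier[of f bs] block_toeplitz_carrier[of g bs]
    by (subst mult_four_block_mat[of _ \<mu> \<mu> _ "total_size bs" _ "total_size bs" _ _ \<mu> _ "total_size bs"])
       (auto simp: right_mult_zero_mat[OF T] left_mult_zero_mat[OF T] right_add_zero_mat[OF mult_carrier_mat[OF T T]])
  also have "\<dots> = block_toeplitz (\<lambda>k c. \<Sum>i\<le>k. f i c * g (k - i) c) (b # bs)"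
    unfolding TT Cons.IH unfolding b block_toeplitz_Cons T_def ..
  finally show ?case .
qed (simp add: block_toeplitz_def)

definition jordan_coeff :: "nat \<Rightarrow> complex \<Rightarrow> complex" where
  "jordan_coeff k c = (if k = 0 then c else if k = 1 then 1 else 0)"

text \<open>\<open>jordan_matrix\<close> expects the size before the eigenvalue, hence the
  swap.\<close>

lemma jordan_matrix_eq_block_toeplitz:
  "jordan_matrix (map prod.swap bs) = block_toeplitz jordan_coeff bs"
  unfolding jordan_matrix_def block_toeplitz_def
  by (auto intro!: arg_cong[where f = diag_block_mat] eq_matI simp: jordan_block_def jordan_coeff_def) arith

lemma e_plus_blocks_eq_block_toeplitz:
  "diag_block_mat (map (\<lambda>b. e_plus_block b x) bs) = block_toeplitz (\<lambda>k c. l_plus k c x) bs"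
  unfolding block_toeplitz_def e_plus_block_def by (simp add: case_prod_unfold)

section \<open>Bidiagonal matrices\<close>

definition bidiagonal :: "nat \<Rightarrow> complex mat \<Rightarrow> (nat \<Rightarrow> complex) \<Rightarrow> (nat \<Rightarrow> complex) \<Rightarrow> bool" where
  "bidiagonal n X a s \<longleftrightarrow> X \<in> carrier_mat n n \<and> (\<forall>i<n. \<forall>j<n.
     X $$ (i, j) = (if j = i then a i else if j = Suc i then s i else 0))"

lemma bidiagonal_mult_left:
  assumes "bidiagonal n X a s" "P \<in> carrier_mat n n" "i < n" "j < n"
  shows "(X * P) $$ (i, j) = a i * P $$ (i, j) + (if Suc i < n then s i * P $$ (Suc i, j) else 0)"
proof -
  have "(X * P) $$ (i, j) = (\<Sum>l = 0..<n. X $$ (i, l) * P $$ (l, j))"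
    using assms by (auto simp: bidiagonal_def scalar_prod_def)
  also have "\<dots> = (\<Sum>l = 0..<n. (if l = i then a i * P $$ (i, j) else 0) +
      (if l = Suc i then s i * P $$ (Suc i, j) else 0))"
    using assms by (intro sum.cong) (auto simp: bidiagonal_def)
  finally show ?thesis using assms(3) by (simp add: sum.distrib)
qed

lemma bidiagonal_mult_right:
  assumes "bidiagonal n X a s" "P \<in> carrier_mat n n" "i < n" "j < n"
  shows "(P * X) $$ (i, j) = P $$ (i, j) * a j + (if j > 0 then P $$ (i, j - 1) * s (j - 1) else 0)"
proof -
  have "(P * X) $$ (i, j) = (\<Sum>l = 0..<n. P $$ (i, l) * X $$ (l, j))"
    using assms by (auto simp: bidiagonal_def scalar_prod_def)
  also have "\<dots> = (\<Sum>l = 0..<n. (if l = j then P $$ (i, j) * a j else 0) +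
      (if l = j - 1 then if j > 0 then P $$ (i, j - 1) * s (j - 1) else 0 else 0))"
    using assms by (intro sum.cong) (auto simp: bidiagonal_def)
  finally show ?thesis using assms(4) by (simp add: sum.distrib less_imp_diff_less)
qed

text \<open>Here \<open>c\<close> lists the diagonal entries and \<open>s i \<in> {0, 1}\<close> tells whether \<open>i\<close> and \<open>i + 1\<close> belong
  to the same block; both are independent of \<open>f\<close>.\<close>

lemma block_toeplitz_bidiagonal:
  obtains c s where
    "\<And>i. i < total_size bs \<Longrightarrow> c i \<in> fst ` set bs"
    "\<And>i. Suc i < total_size bs \<Longrightarrow> s i \<noteq> 0 \<Longrightarrow> c i = c (Suc i)"
    "\<And>f. (\<And>k c. k \<ge> 2 \<Longrightarrow> f k c = 0) \<Longrightarrow>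
       bidiagonal (total_size bs) (block_toeplitz f bs) (\<lambda>i. f 0 (c i)) (\<lambda>i. s i * f 1 (c i))"
    "\<And>f i. i < total_size bs \<Longrightarrow> block_toeplitz f bs $$ (i, i) = f 0 (c i)"
proof -
  obtain c same where *: "\<And>i. i < total_size bs \<Longrightarrow> c i \<in> fst ` set bs"
    "\<And>i. i < total_size bs \<Longrightarrow> same i i"
    "\<And>i j. i < total_size bs \<Longrightarrow> j < total_size bs \<Longrightarrow> same i j \<Longrightarrow> c i = c j"
    "\<And>f i j. i < total_size bs \<Longrightarrow> j < total_size bs \<Longrightarrow>
       block_toeplitz f bs $$ (i, j) = (if i \<le> j \<and> same i j then f (j - i) (c i) else 0)"
    by (rule block_toeplitz_index[of bs]) blast
  show ?thesis
  proof (rule that[of c "\<lambda>i. if same i (Suc i) then 1 else 0"])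
    fix f :: "nat \<Rightarrow> complex \<Rightarrow> complex" assume f: "\<And>k c. k \<ge> 2 \<Longrightarrow> f k c = 0"
    show "bidiagonal (total_size bs) (block_toeplitz f bs) (\<lambda>i. f 0 (c i))
        (\<lambda>i. (if same i (Suc i) then 1 else 0) * f 1 (c i))"
      unfolding bidiagonal_def
    proof (intro conjI block_toeplitz_carrier allI impI)
      fix i j assume ij: "i < total_size bs" "j < total_size bs"
      consider "j < i" | "j = i" | "j = Suc i" | "j - i \<ge> 2" by linarith
      then show "block_toeplitz f bs $$ (i, j) = (if j = i then f 0 (c i)
          else if j = Suc i then (if same i (Suc i) then 1 else 0) * f 1 (c i) else 0)"
        by cases (use *(2,4) ij f[of "j - i"] in auto)
    qed
  next
    fix i assume "Suc i < total_size bs" "(if same i (Suc i) then 1 else 0) \<noteq> (0 :: complex)"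
    then show "c i = c (Suc i)" using *(3)[of i "Suc i"] by (simp split: if_splits)
  next
    fix f i assume "i < total_size bs"
    then show "block_toeplitz f bs $$ (i, i) = f 0 (c i)" using *(2)[of i] *(4)[of i i f] by simp
  qed (rule *(1))
qed

text \<open>A Horner step: each block is a polynomial in the nilpotent shift, and its constant term
  is split off from a multiple of the shift. It drives an induction on the degree.\<close>

lemma block_toeplitz_nilpotent_split:
  "block_toeplitz f bs = block_toeplitz (\<lambda>k c. if k = 0 then f 0 c else 0) bs +
     block_toeplitz (\<lambda>k. f (Suc k)) bs * block_toeplitz (\<lambda>k c. if k = 1 then 1 else 0) bs"
proof -
  obtain c same where *: "\<And>f i j. i < total_size bs \<Longrightarrow> j < total_size bs \<Longrightarrow>
       block_toeplitz f bs $$ (i, j) = (if i \<le> j \<and> same i j then f (j - i) (c i) else 0)"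
    by (rule block_toeplitz_index[of bs]) blast
  have shift: "(\<Sum>i\<le>k. f (Suc i) c * (if k - i = 1 then 1 else 0)) = (if k = 0 then 0 else f k c)" for k c
  proof (cases k)
    case (Suc l)
    have "(\<Sum>i\<le>k. f (Suc i) c * (if k - i = 1 then 1 else 0)) =
        (\<Sum>i\<le>k. if i = l then f (Suc i) c else 0)"
      by (intro sum.cong) (use Suc in auto)
    then show ?thesis using Suc by simp
  qed simp
  show ?thesis
    unfolding block_toeplitz_mult shift by (rule eq_matI) (auto simp: *)
qed

section \<open>The functions \<open>e\<^sup>+\<close> and \<open>l\<^sup>+\<close>\<close>

text \<open>Leibniz rule with two surviving terms, as the second derivative of the affine factor
  vanishes. The truncated \<open>k - 1\<close> is harmless at \<open>k = 0\<close> because of the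
  factor \<open>of_nat k\<close>.\<close>

lemma higher_deriv_affine_mult:
  fixes E :: "complex \<Rightarrow> complex"
  assumes "E holomorphic_on UNIV"
  shows "(deriv ^^ k) (\<lambda>c. (a + b * c) * E c) z =
    (a + b * z) * (deriv ^^ k) E z + of_nat k * b * (deriv ^^ (k - 1)) E z"
proof (induction k arbitrary: z)
  case (Suc k)
  have fd: "(deriv ^^ j) E field_differentiable at z" for j
    using holomorphic_higher_deriv[OF assms open_UNIV]
    by (auto simp: holomorphic_on_def)
  have d: "((deriv ^^ j) E has_field_derivative (deriv ^^ Suc j) E z) (at z)" for j
    using fd[of j] by (simp add: field_differentiable_derivI)
  have "((\<lambda>z. (a + b * z) * (deriv ^^ k) E z + of_nat k * b * (deriv ^^ (k - 1)) E z)
     has_field_derivative (b * (deriv ^^ k) E z + (deriv ^^ Suc k) E z * (a + b * z)) +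
        of_nat k * b * (deriv ^^ Suc (k - 1)) E z) (at z)"
    by (rule derivative_eq_intros d refl | simp)+
  also have "(b * (deriv ^^ k) E z + (deriv ^^ Suc k) E z * (a + b * z)) +
        of_nat k * b * (deriv ^^ Suc (k - 1)) E z =
      (a + b * z) * (deriv ^^ Suc k) E z + of_nat (Suc k) * b * (deriv ^^ k) E z"
    by (cases k) (auto simp: algebra_simps)
  finally have *: "((\<lambda>z. (a + b * z) * (deriv ^^ k) E z + of_nat k * b * (deriv ^^ (k - 1)) E z)
     has_field_derivative (a + b * z) * (deriv ^^ Suc k) E z + of_nat (Suc k) * b * (deriv ^^ k) E z) (at z)" .
  have "(deriv ^^ k) (\<lambda>c. (a + b * c) * E c) =
      (\<lambda>z. (a + b * z) * (deriv ^^ k) E z + of_nat k * b * (deriv ^^ (k - 1)) E z)"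
    using Suc.IH by blast
  then show ?case using DERIV_imp_deriv[OF *] by simp
qed simp

text \<open>\<open>rGamma\<close> is entire, so holomorphy in \<open>c\<close> is immediate and
  poles of \<open>Gamma (x - c)\<close> need no case distinction.\<close>

lemma e_plus_rGamma: "e_plus c x = Gamma x * rGamma (x - c)"
  by (simp add: e_plus_def rGamma_inverse_Gamma divide_inverse)

lemma e_plus_shift:
  assumes "x \<notin> \<int>"
  shows "e_plus c (x - 1) = (1 - c / (x - 1)) * e_plus c x"
proof -
  have x: "x - 1 \<noteq> 0" "x - 1 \<notin> \<int>\<^sub>\<le>\<^sub>0"
  proof -
    have "x - 1 \<notin> \<int>" using assms Ints_add[of "x - 1" 1] by auto
    then show "x - 1 \<noteq> 0" "x - 1 \<notin> \<int>\<^sub>\<le>\<^sub>0" by (auto dest: nonpos_Ints_Int)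
  qed
  have "rGamma (x - 1 - c) = (x - 1 - c) * rGamma (x - c)"
    using rGamma_plus1[of "x - 1 - c"] by (simp add: algebra_simps)
  moreover have "Gamma x = (x - 1) * Gamma (x - 1)"
    using Gamma_plus1[OF x(2)] by simp
  moreover have "x - 1 - c = (1 - c / (x - 1)) * (x - 1)"
    using x(1) by (simp add: left_diff_distrib)
  ultimately show ?thesis unfolding e_plus_rGamma by (simp only: mult_ac)
qed

text \<open>The \<open>k\<close>-th derivative in \<open>c\<close> of \<open>e_plus_shift\<close>;
  it is superdiagonal \<open>k\<close> of \<open>N(x-1) = (I - D/(x-1)) N(x)\<close>.\<close>

lemma l_plus_shift:
  assumes "x \<notin> \<int>"
  shows "l_plus k c (x - 1) =
    (1 - c / (x - 1)) * l_plus k c x - (if k = 0 then 0 else l_plus (k - 1) c x / (x - 1))"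
proof -
  have "(\<lambda>c. e_plus c x) holomorphic_on UNIV"
    unfolding e_plus_rGamma by (intro holomorphic_intros)
  note * = higher_deriv_affine_mult[OF this, of k 1 "- 1 / (x - 1)" c]
  have "(\<lambda>c. e_plus c (x - 1)) = (\<lambda>c. (1 + - 1 / (x - 1) * c) * e_plus c x)"
    using e_plus_shift[OF assms] by simp
  then have "l_plus k c (x - 1) =
     ((1 + - 1 / (x - 1) * c) * (deriv ^^ k) (\<lambda>c. e_plus c x) c +
       of_nat k * (- 1 / (x - 1)) * (deriv ^^ (k - 1)) (\<lambda>c. e_plus c x) c) / fact k"
    unfolding l_plus_def using * by simp
  also have "\<dots> = (1 - c / (x - 1)) * l_plus k c x -
      of_nat k * (deriv ^^ (k - 1)) (\<lambda>c. e_plus c x) c / fact k / (x - 1)"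
    by (simp add: l_plus_def add_divide_distrib diff_divide_distrib)
  also have "of_nat k * (deriv ^^ (k - 1)) (\<lambda>c. e_plus c x) c / fact k / (x - 1) =
      (if k = 0 then 0 else l_plus (k - 1) c x / (x - 1))"
    by (cases k) (simp_all add: l_plus_def del: of_nat_Suc)
  finally show ?thesis .
qed

lemma e_plus_nonzero:
  assumes "x \<notin> \<int>" "x - c \<notin> \<int>"
  shows "e_plus c x \<noteq> 0"
  using assms by (auto simp: e_plus_def Gamma_eq_zero_iff dest: nonpos_Ints_Int)

section \<open>Intertwiners of Jordan matrices\<close>

lemma sorted_wrt_unique:
  assumes "sorted_wrt P xs" "sorted_wrt P ys" "mset xs = mset ys"
    and antisym: "\<And>x y. P x y \<Longrightarrow> P y x \<Longrightarrow> x = y"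
  shows "xs = ys"
  using assms(1-3)
proof (induction xs arbitrary: ys)
  case (Cons x xs)
  then obtain y zs where ys: "ys = y # zs" by (cases ys) auto
  have "x = y"
  proof (rule ccontr)
    assume "x \<noteq> y"
    have "set (x # xs) = set (y # zs)" using Cons.prems(3) ys mset_eq_setD by blast
    with \<open>x \<noteq> y\<close> have "y \<in> set xs" "x \<in> set zs" by auto
    with Cons.prems(1,2) ys have "P x y" "P y x" by auto
    with antisym \<open>x \<noteq> y\<close> show False by blast
  qed
  with Cons ys show ?case by auto
qed simp

text \<open>Both lists are Jordan normal forms of the same matrix, so each pair of size and
  eigenvalue occurs equally often in both; the prescribed order then recovers the list from its
  multiset.\<close>

lemma similar_jordan_matrices_imp_eq:
  assumes "block_data n bs" "block_data n bs'"
    and R: "R \<in> carrier_mat n n" "W \<in> carrier_mat n n" "R * W = 1\<^sub>m n" "W * R = 1\<^sub>m n"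
    and inter: "block_toeplitz jordan_coeff bs * R = R * block_toeplitz jordan_coeff bs'"
  shows "bs = bs'"
proof -
  define D where "D = block_toeplitz jordan_coeff bs"
  define D' where "D' = block_toeplitz jordan_coeff bs'"
  have size: "total_size bs = n" "total_size bs' = n" using assms(1,2) by (auto simp: block_data_def)
  have carr: "D \<in> carrier_mat n n" "D' \<in> carrier_mat n n"
    using block_toeplitz_carrier[of jordan_coeff bs] block_toeplitz_carrier[of jordan_coeff bs']
    by (simp_all add: D_def D'_def size)
  have "D = D * (R * W)" using R carr by simp
  also have "\<dots> = R * D' * W"
    using assoc_mult_mat[OF carr(1) R(1,2)] inter by (simp add: D_def D'_def)
  finally have "D = R * D' * W" .
  from similar_mat_witI[OF R(3,4) this carr R(1,2)] have "similar_mat_wit D D' R W" .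
  then have sim: "similar_mat D D'" unfolding similar_mat_def by blast
  have pos: "0 \<notin> fst ` set (map prod.swap bs)" "0 \<notin> fst ` set (map prod.swap bs')"
    using assms(1,2) by (auto simp: block_data_def)
  have nf: "jordan_nf D (map prod.swap bs)" "jordan_nf D (map prod.swap bs')"
    unfolding jordan_nf_def jordan_matrix_eq_block_toeplitz
    using pos sim similar_mat_refl[OF carr(1)] by (simp_all add: D_def D'_def)
  have "mset (map prod.swap bs) = mset (map prod.swap bs')"
  proof (rule multiset_eqI)
    fix b :: "nat \<times> complex"
    obtain k c where b: "b = (k, c)" by (cases b)
    show "count (mset (map prod.swap bs)) b = count (mset (map prod.swap bs')) b"
    \<comment> \<open>The count of Jordan blocks applies to positive sizes; size 0 occurs in neither
      list.\<close>
    proof (cases "k = 0")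
      case True
      then have "b \<notin> set (map prod.swap bs)" "b \<notin> set (map prod.swap bs')" 
        using pos b by force+
      then show ?thesis unfolding set_mset_mset[symmetric] not_in_iff by (simp only:)
    next
      case False
      from compute_nr_of_jordan_blocks[OF nf(1) False] compute_nr_of_jordan_blocks[OF nf(2) False]
      have "length (filter ((=) (k, c)) (map prod.swap bs)) = length (filter ((=) (k, c)) (map prod.swap bs'))"
        by metis
      then show ?thesis unfolding b count_mset count_list_eq_length_filter .
    qed
  qed
  then have "image_mset prod.swap (mset (map prod.swap bs)) = image_mset prod.swap (mset (map prod.swap bs'))"
    by (rule arg_cong)
  then have "mset bs = mset bs'" by (simp add: image_mset.compositionality)
  then show ?thesis
    using assms(1,2) unfolding block_data_def
    by (elim conjE sorted_wrt_unique) (auto simp: prec_def)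
qed

text \<open>\<open>R\<close> has no entries between different \<open>c\<close>, so it commutes with
  the diagonal part of the Jordan matrix and hence with its nilpotent part \<open>S\<close>. Every
  block Toeplitz matrix is built from \<open>S\<close> and diagonal matrices depending only on
  \<open>c\<close>.\<close>

lemma commutes_with_block_toeplitz:
  assumes R: "R \<in> carrier_mat (total_size bs) (total_size bs)"
    and comm: "block_toeplitz jordan_coeff bs * R = R * block_toeplitz jordan_coeff bs"
  shows "block_toeplitz f bs * R = R * block_toeplitz f bs"
proof -
  define n where "n = total_size bs"
  note R = R[folded n_def]
  have T: "block_toeplitz f bs \<in> carrier_mat n n" for f
    unfolding n_def by (rule block_toeplitz_carrier)
  obtain c s where s: "\<And>i. Suc i < n \<Longrightarrow> s i \<noteq> 0 \<Longrightarrow> c i = c (Suc i)"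
    and bd: "\<And>f. (\<And>k c. k \<ge> 2 \<Longrightarrow> f k c = 0) \<Longrightarrow>
       bidiagonal n (block_toeplitz f bs) (\<lambda>i. f 0 (c i)) (\<lambda>i. s i * f 1 (c i))"
    unfolding n_def by (rule block_toeplitz_bidiagonal[of bs]) blast
  have J: "bidiagonal n (block_toeplitz jordan_coeff bs) c s"
    using bd[of jordan_coeff] by (simp add: jordan_coeff_def)
  have eq: "c i * R $$ (i, j) + (if Suc i < n then s i * R $$ (Suc i, j) else 0) =
      R $$ (i, j) * c j + (if j > 0 then R $$ (i, j - 1) * s (j - 1) else 0)"
    if "i < n" "j < n" for i j
    using bidiagonal_mult_left[OF J R that] bidiagonal_mult_right[OF J R that] comm by simp
  \<comment> \<open>Induction from the lower left corner: the neighbours \<open>(i + 1, j)\<close>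
    and \<open>(i, j - 1)\<close> enter only when the coefficient \<open>s\<close> is nonzero, and
    then the parameters are unchanged, so they differ there as well.\<close>
  have zero: "R $$ (i, j) = 0" if "i < n" "j < n" "c i \<noteq> c j" for i j
    using that
  proof (induction "j + (n - i)" arbitrary: i j rule: less_induct)
    case less
    have 1: "(if Suc i < n then s i * R $$ (Suc i, j) else 0) = 0"
    proof (cases "Suc i < n \<and> s i \<noteq> 0")
      case True
      then have "R $$ (Suc i, j) = 0"
        using less.prems s[of i] by (intro less.hyps) auto
      then show ?thesis by simp
    qed auto
    have 2: "(if j > 0 then R $$ (i, j - 1) * s (j - 1) else 0) = 0"
    proof (cases "j > 0 \<and> s (j - 1) \<noteq> 0")
      case True
      then have "R $$ (i, j - 1) = 0"
        using less.prems s[of "j - 1"] by (intro less.hyps) auto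
      then show ?thesis by simp
    qed auto
    have "(c i - c j) * R $$ (i, j) = 0"
      using eq[OF less.prems(1,2)] unfolding 1 2 by (simp add: algebra_simps)
    with less.prems(3) show ?case by simp
  qed
  define S where "S = block_toeplitz (\<lambda>k c. if k = 1 then 1 else 0) bs"
  have Sc: "S \<in> carrier_mat n n" unfolding S_def by (rule T)
  have cR: "c i * R $$ (i, j) = R $$ (i, j) * c j" if "i < n" "j < n" for i j
    using zero[OF that] by (cases "c i = c j") auto
  \<comment> \<open>Removing the diagonal contribution \<open>cR\<close> from the entry equation
    \<open>eq\<close> leaves the nilpotent part.\<close>
  have SR: "S * R = R * S"
  proof (rule eq_matI)
    fix i j assume "i < dim_row (R * S)" "j < dim_col (R * S)"
    then have ij: "i < n" "j < n" using R Sc by auto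
    have bdS: "bidiagonal n S (\<lambda>i. 0) (\<lambda>i. s i)"
      using bd[of "\<lambda>k c. if k = 1 then 1 else 0"] by (simp add: S_def)
    show "(S * R) $$ (i, j) = (R * S) $$ (i, j)"
      unfolding bidiagonal_mult_left[OF bdS R ij] bidiagonal_mult_right[OF bdS R ij]
      using eq[OF ij] cR[OF ij] by simp
  qed (use R Sc in auto)
  have diag: "block_toeplitz (\<lambda>k c. if k = 0 then f 0 c else 0) bs * R =
      R * block_toeplitz (\<lambda>k c. if k = 0 then f 0 c else 0) bs" for f
  proof (rule eq_matI)
    let ?X = "block_toeplitz (\<lambda>k c. if k = 0 then f 0 c else 0) bs"
    fix i j assume "i < dim_row (R * ?X)" "j < dim_col (R * ?X)"
    then have ij: "i < n" "j < n" using R T[of "\<lambda>k c. if k = 0 then f 0 c else 0"] by auto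
    have bdX: "bidiagonal n ?X (\<lambda>i. f 0 (c i)) (\<lambda>i. 0)"
      using bd[of "\<lambda>k c. if k = 0 then f 0 c else 0"] by simp
    show "(?X * R) $$ (i, j) = (R * ?X) $$ (i, j)"
      unfolding bidiagonal_mult_left[OF bdX R ij] bidiagonal_mult_right[OF bdX R ij]
      using zero[OF ij] by (cases "c i = c j") auto
  qed (use R T in \<open>auto simp: n_def\<close>)
  have finite: "block_toeplitz f bs * R = R * block_toeplitz f bs"
    if "\<And>k c. k \<ge> K \<Longrightarrow> f k c = 0" for f K
    using that
  proof (induction K arbitrary: f)
    case 0
    have "block_toeplitz f bs = block_toeplitz (\<lambda>k c. if k = 0 then (\<lambda>k c. 0) 0 c else 0) bs"
      using 0 by (intro arg_cong[where f = "\<lambda>f. block_toeplitz f bs"]) auto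
    then show ?case using diag[of "\<lambda>k c. 0"] by simp
  next
    case (Suc K)
    define X where "X = block_toeplitz (\<lambda>k c. if k = 0 then f 0 c else 0) bs"
    define Z where "Z = block_toeplitz (\<lambda>k. f (Suc k)) bs"
    have X: "X \<in> carrier_mat n n" "X * R = R * X" unfolding X_def by (rule T, rule diag)
    have Z: "Z \<in> carrier_mat n n" "Z * R = R * Z"
      unfolding Z_def using Suc by (auto intro!: T)
    have "(Z * S) * R = Z * (S * R)" using Z(1) Sc R by (rule assoc_mult_mat)
    also have "\<dots> = (Z * R) * S" unfolding SR using Z(1) R Sc by (rule assoc_mult_mat[symmetric])
    also have "\<dots> = R * (Z * S)" unfolding Z(2) using R Z(1) Sc by (rule assoc_mult_mat)
    finally have "(Z * S) * R = R * (Z * S)" .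
    then have "(X + Z * S) * R = R * (X + Z * S)"
      using X Z(1) Sc R by (simp add: add_mult_distrib_mat[of _ n n] mult_add_distrib_mat[of _ n n])
    then show ?case
      using block_toeplitz_nilpotent_split[of f bs] by (simp add: X_def Z_def S_def)
  qed
  \<comment> \<open>Superdiagonals from \<open>n\<close> on lie outside the matrix, so truncating
    \<open>f\<close> reduces to the finite case.\<close>
  have "block_toeplitz f bs = block_toeplitz (\<lambda>k c. if k < n then f k c else 0) bs"
  proof -
    obtain c same where *: "\<And>f i j. i < total_size bs \<Longrightarrow> j < total_size bs \<Longrightarrow>
       block_toeplitz f bs $$ (i, j) = (if i \<le> j \<and> same i j then f (j - i) (c i) else 0)"
      by (rule block_toeplitz_index[of bs]) blast
    show ?thesis by (rule eq_matI) (auto simp: * n_def)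
  qed
  then show ?thesis using finite[of n "\<lambda>k c. if k < n then f k c else 0"] by simp
qed

text \<open>The matrix \<open>I - D/(x-1)\<close> is \<open>block_toeplitz (shift_coeff x) bs\<close>.\<close>

definition shift_coeff :: "complex \<Rightarrow> nat \<Rightarrow> complex \<Rightarrow> complex" where
  "shift_coeff x k c = (if k = 0 then 1 - c / (x - 1) else if k = 1 then - 1 / (x - 1) else 0)"

lemma cocountable_nontrivial: "cocountable \<noteq> bot"
  using right_end_nontrivial unfolding right_end_def by auto

lemma constant_of_eventually_cocountable:
  "eventually (\<lambda>_. Q) cocountable \<Longrightarrow> Q"
  using cocountable_nontrivial eventually_happens by blast

text \<open>By bidiagonality the equation of entry \<open>(i, j)\<close> involves, besides that
  entry, only \<open>(i, j - 1)\<close> and \<open>(i + 1, j)\<close>. Induction from the lower left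
  corner therefore always meets a scalar recurrence with constant inhomogeneity.\<close>

lemma intertwiner_constant:
  assumes size: "total_size bs = n" "total_size bs' = n"
    and P: "\<And>x. P x \<in> carrier_mat n n"
    and approx: "\<And>i j. i < n \<Longrightarrow> j < n \<Longrightarrow> rationally_approximable (\<lambda>x. P x $$ (i, j))"
    and mero: "\<And>i j. i < n \<Longrightarrow> j < n \<Longrightarrow> (\<lambda>x. P x $$ (i, j)) meromorphic_on UNIV"
    and nonres: "\<And>c c' k. c \<in> fst ` set bs \<Longrightarrow> c' \<in> fst ` set bs' \<Longrightarrow> c' - c = of_int k \<Longrightarrow> k = 0"
    and rec: "eventually (\<lambda>x. P (x - 1) * block_toeplitz (shift_coeff x) bs' =
                block_toeplitz (shift_coeff x) bs * P x) cocountable"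
  obtains R where "R \<in> carrier_mat n n" "eventually (\<lambda>x. P x = R) (cosparse UNIV)"
    "block_toeplitz jordan_coeff bs * R = R * block_toeplitz jordan_coeff bs'"
proof -
  obtain c s where c: "\<And>i. i < n \<Longrightarrow> c i \<in> fst ` set bs"
    and bd: "\<And>f. (\<And>k c. k \<ge> 2 \<Longrightarrow> f k c = 0) \<Longrightarrow>
       bidiagonal n (block_toeplitz f bs) (\<lambda>i. f 0 (c i)) (\<lambda>i. s i * f 1 (c i))"
    unfolding size(1)[symmetric] by (rule block_toeplitz_bidiagonal[of bs]) blast
  obtain c' s' where c': "\<And>i. i < n \<Longrightarrow> c' i \<in> fst ` set bs'"
    and bd': "\<And>f. (\<And>k c. k \<ge> 2 \<Longrightarrow> f k c = 0) \<Longrightarrow>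
       bidiagonal n (block_toeplitz f bs') (\<lambda>i. f 0 (c' i)) (\<lambda>i. s' i * f 1 (c' i))"
    unfolding size(2)[symmetric] by (rule block_toeplitz_bidiagonal[of bs']) blast
  have x1: "eventually (\<lambda>x. x - 1 \<noteq> 0) cocountable" by (simp add: eventually_cocountable)
  have entry: "eventually (\<lambda>x. P (x - 1) $$ (i, j) * (x - 1 - c' j) = (x - 1 - c i) * P x $$ (i, j) +
      ((if j > 0 then P (x - 1) $$ (i, j - 1) * s' (j - 1) else 0) -
       (if Suc i < n then s i * P x $$ (Suc i, j) else 0))) cocountable"
    if ij: "i < n" "j < n" for i j
    using rec x1
  proof eventually_elim
    case (elim x)
    have sc: "\<And>k c. k \<ge> 2 \<Longrightarrow> shift_coeff x k c = 0" by (simp add: shift_coeff_def)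
    have sc01: "shift_coeff x 0 c = 1 - c / (x - 1)" "shift_coeff x 1 c = - 1 / (x - 1)" for c
      by (simp_all add: shift_coeff_def)
    have "P (x - 1) $$ (i, j) * (1 - c' j / (x - 1)) +
         (if j > 0 then P (x - 1) $$ (i, j - 1) * (s' (j - 1) * (- 1 / (x - 1))) else 0) =
       (1 - c i / (x - 1)) * P x $$ (i, j) +
         (if Suc i < n then s i * (- 1 / (x - 1)) * P x $$ (Suc i, j) else 0)"
      using bidiagonal_mult_right[OF bd'[of "shift_coeff x", OF sc] P[of "x - 1"] ij] bidiagonal_mult_left[OF bd[of "shift_coeff x", OF sc] P[of x] ij]
      by (simp only: elim(1) sc01)
    then have scaled: "(P (x - 1) $$ (i, j) * (1 - c' j / (x - 1)) +
         (if j > 0 then P (x - 1) $$ (i, j - 1) * (s' (j - 1) * (- 1 / (x - 1))) else 0)) * (x - 1) =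
       ((1 - c i / (x - 1)) * P x $$ (i, j) +
         (if Suc i < n then s i * (- 1 / (x - 1)) * P x $$ (Suc i, j) else 0)) * (x - 1)"
      by (rule arg_cong)
    have clear: "(p * (1 - d' / e) + (if b then q * (t * (- 1 / e)) else 0)) * e =
        p * (e - d') - (if b then q * t else 0)"
      "((1 - d / e) * p + (if b then t * (- 1 / e) * q else 0)) * e =
        (e - d) * p - (if b then t * q else 0)"
      if "e \<noteq> 0" for p d d' e q t :: complex and b
      using that by (auto simp: field_simps)
    have rearrange: "a = u + (b - v)" if "a - b = u - v" for a b u v :: complex
      using that by (simp add: algebra_simps)
    show ?case
      using scaled unfolding clear(1)[OF elim(2)] clear(2)[OF elim(2)] by (rule rearrange)
  qed
  have const: "\<exists>r. eventually (\<lambda>x. P x $$ (i, j) = r) (cosparse UNIV)" if "i < n" "j < n" for i j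
    using that
  proof (induction "j + (n - i)" arbitrary: i j rule: less_induct)
    case less
    have "\<exists>r1. eventually (\<lambda>x. (if j > 0 then P (x - 1) $$ (i, j - 1) * s' (j - 1) else 0) = r1) cocountable"
    proof (cases "j > 0")
      case True
      have "\<exists>r. eventually (\<lambda>x. P x $$ (i, j - 1) = r) (cosparse UNIV)"
        by (rule less.hyps) (use True less.prems in arith)+
      then obtain r where "eventually (\<lambda>x. P x $$ (i, j - 1) = r) (cosparse UNIV)" by blast
      from eventually_cocountable_shift[OF eventually_cosparse_imp_cocountable[OF this], of 1]
      have "eventually (\<lambda>x. (if j > 0 then P (x - 1) $$ (i, j - 1) * s' (j - 1) else 0) = r * s' (j - 1)) cocountable"
        by eventually_elim (use True in simp)
      then show ?thesis by blast
    qed (auto intro: exI[of _ 0])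
    then obtain r1 where r1:
      "eventually (\<lambda>x. (if j > 0 then P (x - 1) $$ (i, j - 1) * s' (j - 1) else 0) = r1) cocountable" by blast
    have "\<exists>r2. eventually (\<lambda>x. (if Suc i < n then s i * P x $$ (Suc i, j) else 0) = r2) cocountable"
    proof (cases "Suc i < n")
      case True
      have "\<exists>r. eventually (\<lambda>x. P x $$ (Suc i, j) = r) (cosparse UNIV)"
        by (rule less.hyps) (use True less.prems in arith)+
      then obtain r where "eventually (\<lambda>x. P x $$ (Suc i, j) = r) (cosparse UNIV)" by blast
      from eventually_cosparse_imp_cocountable[OF this]
      have "eventually (\<lambda>x. (if Suc i < n then s i * P x $$ (Suc i, j) else 0) = s i * r) cocountable"
        by eventually_elim (use True in simp)
      then show ?thesis by blast
    qed (auto intro: exI[of _ 0])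
    then obtain r2 where r2:
      "eventually (\<lambda>x. (if Suc i < n then s i * P x $$ (Suc i, j) else 0) = r2) cocountable" by blast
    have "first_order_recurrence (c i) (c' j) (r1 - r2) (\<lambda>x. P x $$ (i, j))"
      unfolding first_order_recurrence_def using entry[OF less.prems] r1 r2
      by eventually_elim simp
    then show ?case
      using less.prems by (intro recurrence_constant approx mero nonres[OF c c'])
  qed
  then obtain r where r: "\<And>i j. i < n \<Longrightarrow> j < n \<Longrightarrow> eventually (\<lambda>x. P x $$ (i, j) = r i j) (cosparse UNIV)"
    by metis
  define R where "R = mat n n (\<lambda>(i, j). r i j)"
  have R: "R \<in> carrier_mat n n" by (simp add: R_def)
  have "eventually (\<lambda>x. \<forall>i\<in>{..<n}. \<forall>j\<in>{..<n}. P x $$ (i, j) = r i j) (cosparse UNIV)"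
    using r by (intro eventually_ball_finite ballI) auto
  then have PR: "eventually (\<lambda>x. P x = R) (cosparse UNIV)"
  proof eventually_elim
    case (elim x)
    show ?case by (rule eq_matI) (use elim P[of x] in \<open>auto simp: R_def\<close>)
  qed
  have J: "bidiagonal n (block_toeplitz jordan_coeff bs) c s"
    using bd[of jordan_coeff] by (simp add: jordan_coeff_def)
  have J': "bidiagonal n (block_toeplitz jordan_coeff bs') c' s'"
    using bd'[of jordan_coeff] by (simp add: jordan_coeff_def)
  have "block_toeplitz jordan_coeff bs * R = R * block_toeplitz jordan_coeff bs'"
  proof (rule eq_matI)
    fix i j assume "i < dim_row (R * block_toeplitz jordan_coeff bs')"
      "j < dim_col (R * block_toeplitz jordan_coeff bs')"
    then have ij: "i < n" "j < n" using size by (auto simp: R_def)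
    \<comment> \<open>For constant \<open>P\<close> the terms with \<open>x - 1\<close> cancel in
      \<open>entry\<close>, and the entry of \<open>D R = R D'\<close> remains; being free of
      \<open>x\<close>, it holds outright.\<close>
    have "eventually (\<lambda>x. c i * R $$ (i, j) + (if Suc i < n then s i * R $$ (Suc i, j) else 0) =
        R $$ (i, j) * c' j + (if j > 0 then R $$ (i, j - 1) * s' (j - 1) else 0)) cocountable"
      using entry[OF ij] eventually_cosparse_imp_cocountable[OF PR]
        eventually_cocountable_shift[OF eventually_cosparse_imp_cocountable[OF PR], of 1]
      by eventually_elim (auto simp: algebra_simps)
    then show "(block_toeplitz jordan_coeff bs * R) $$ (i, j) = (R * block_toeplitz jordan_coeff bs') $$ (i, j)"
      unfolding bidiagonal_mult_left[OF J R ij] bidiagonal_mult_right[OF J' R ij]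
      by (rule constant_of_eventually_cocountable)
  qed (use size in \<open>auto simp: R_def\<close>)
  with R PR show ?thesis by (rule that)
qed

text \<open>This is \<open>N(x-1) = (I - D/(x-1)) N(x)\<close>: the right side of
  \<open>l_plus_shift\<close> is a Cauchy product with \<open>shift_coeff\<close>, which vanishes
  beyond index 1.\<close>

lemma e_plus_blocks_shift:
  assumes "x \<notin> \<int>"
  shows "block_toeplitz (\<lambda>k c. l_plus k c (x - 1)) bs =
    block_toeplitz (shift_coeff x) bs * block_toeplitz (\<lambda>k c. l_plus k c x) bs"
proof -
  have "l_plus k c (x - 1) = (\<Sum>i\<le>k. shift_coeff x i c * l_plus (k - i) c x)" for k c
  proof (cases k)
    case 0
    then show ?thesis using l_plus_shift[OF assms, of k c] by (simp add: shift_coeff_def)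
  next
    case (Suc m)
    have "(\<Sum>i\<le>k. shift_coeff x i c * l_plus (k - i) c x) =
        shift_coeff x 0 c * l_plus k c x + (\<Sum>i\<le>m. shift_coeff x (Suc i) c * l_plus (m - i) c x)"
      unfolding Suc by (simp add: sum.atMost_Suc_shift del: sum.atMost_Suc)
    also have "(\<Sum>i\<le>m. shift_coeff x (Suc i) c * l_plus (m - i) c x) =
        (\<Sum>i\<le>m. if i = 0 then - 1 / (x - 1) * l_plus m c x else 0)"
      by (intro sum.cong) (auto simp: shift_coeff_def)
    finally show ?thesis using l_plus_shift[OF assms, of k c] Suc by (simp add: shift_coeff_def)
  qed
  then show ?thesis unfolding block_toeplitz_mult by simp
qed

text \<open>The matrix is upper triangular with diagonal entries \<open>e_plus c x\<close>, which
  are nonzero when neither \<open>x\<close> nor \<open>x - c\<close> is an integer.\<close>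

lemma e_plus_blocks_invertible:
  assumes "x \<notin> \<int>" "\<forall>c\<in>fst ` set bs. x - c \<notin> \<int>"
  shows "\<exists>W\<in>carrier_mat (total_size bs) (total_size bs).
    block_toeplitz (\<lambda>k c. l_plus k c x) bs * W = 1\<^sub>m (total_size bs)"
proof -
  let ?N = "block_toeplitz (\<lambda>k c. l_plus k c x) bs"
  obtain c same where c: "\<And>i. i < total_size bs \<Longrightarrow> c i \<in> fst ` set bs"
    "\<And>i. i < total_size bs \<Longrightarrow> same i i"
    and idx: "\<And>f i j. i < total_size bs \<Longrightarrow> j < total_size bs \<Longrightarrow>
       block_toeplitz f bs $$ (i, j) = (if i \<le> j \<and> same i j then f (j - i) (c i) else 0)"
    by (rule block_toeplitz_index[of bs]) blast
  have "upper_triangular ?N" by (rule upper_triangularI) (auto simp: idx)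
  from det_upper_triangular[OF this block_toeplitz_carrier]
  have det: "det ?N = prod_list (diag_mat ?N)" .
  have "?N $$ (i, i) \<noteq> 0" if "i < total_size bs" for i
    using that c[OF that] assms by (auto simp: idx l_plus_def e_plus_nonzero)
  then have "0 \<notin> set (diag_mat ?N)" by (auto simp: diag_mat_def)
  then have "det ?N \<noteq> 0" unfolding det by (simp add: prod_list_zero_iff)
  from det_non_zero_imp_unit[OF block_toeplitz_carrier this, unfolded Units_def, of "()"]
  show ?thesis by (auto simp: ring_mat_def)
qed

lemma eventually_e_plus_blocks_invertible:
  "eventually (\<lambda>x. x \<notin> \<int> \<and> (\<exists>W\<in>carrier_mat (total_size bs) (total_size bs).
     block_toeplitz (\<lambda>k c. l_plus k c x) bs * W = 1\<^sub>m (total_size bs))) cocountable"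
proof -
  have *: "eventually (\<lambda>x. x \<notin> \<int>) cocountable" by (simp add: eventually_cocountable countable_int)
  then have "eventually (\<lambda>x. \<forall>c\<in>fst ` set bs. x - c \<notin> \<int>) cocountable"
    by (intro eventually_ball_finite ballI eventually_cocountable_shift) auto
  with * show ?thesis
  proof eventually_elim
    case (elim x)
    with e_plus_blocks_invertible[OF elim] show ?case by blast
  qed
qed

section \<open>Uniqueness of the normal form\<close>

text \<open>Multiplied by \<open>N(x)\<close> on the right, both sides equal \<open>Y(x-1)\<close>;
  \<open>N(x)\<close> is invertible off a countable set and cancels. The transcendental factor
  disappears, and only \<open>M\<close>, \<open>B\<close> and \<open>I - D/(x-1)\<close>
  remain.\<close>

lemma gauge_equation:
  assumes B: "B \<in> fun_mat n F" and M: "M \<in> fun_mat n F'"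
    and size: "total_size bs = n"
    and sol: "solves_system B Y"
    and Y: "eventually (\<lambda>x. Y x = M x * block_toeplitz (\<lambda>k c. l_plus k c x) bs) (cosparse UNIV)"
  shows "eventually (\<lambda>x. M (x - 1) * block_toeplitz (shift_coeff x) bs = B x * M x) cocountable"
proof -
  note Y' = eventually_cosparse_imp_cocountable[OF Y]
  show ?thesis
    using eventually_cosparse_imp_cocountable[OF sol[unfolded solves_system_def]] Y'
      eventually_cocountable_shift[OF Y', of 1] eventually_e_plus_blocks_invertible[of bs]
  proof eventually_elim
    case (elim x)
    define A where "A = block_toeplitz (shift_coeff x) bs"
    define N where "N = block_toeplitz (\<lambda>k c. l_plus k c x) bs"
    have carr: "A \<in> carrier_mat n n" "N \<in> carrier_mat n n"
      using block_toeplitz_carrier[of _ bs] by (simp_all add: A_def N_def size)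
    have M: "M y \<in> carrier_mat n n" "B y \<in> carrier_mat n n" for y
      using M B by (auto simp: fun_mat_def)
    from elim(4) obtain W where W: "W \<in> carrier_mat n n" "N * W = 1\<^sub>m n"
      unfolding N_def size by blast
    have "(M (x - 1) * A) * N = M (x - 1) * (A * N)" using M(1) carr by (rule assoc_mult_mat)
    also have "\<dots> = Y (x - 1)"
      using elim(3,4) e_plus_blocks_shift[of x bs] by (simp add: A_def N_def)
    also have "\<dots> = B x * (M x * N)" using elim(1,2) by (simp add: N_def)
    also have "\<dots> = (B x * M x) * N" using M(2,1) carr(2) by (rule assoc_mult_mat[symmetric])
    finally have "(M (x - 1) * A) * N * W = (B x * M x) * N * W" by (rule arg_cong)
    moreover have "X * N * W = X" if "X \<in> carrier_mat n n" for X
      using that carr(2) W by (simp add: assoc_mult_mat[of _ n n])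
    ultimately show ?case
      using mult_carrier_mat[OF M(1) carr(1)] mult_carrier_mat[OF M(2) M(1)] by (simp add: A_def)
  qed
qed

lemma fun_mat_mult_entry:
  assumes "A \<in> fun_mat n M_fact_C" "A' \<in> fun_mat n M_fact_C" "i < n" "j < n"
  shows "rationally_approximable (\<lambda>x. (A x * A' x) $$ (i, j))"
    and "(\<lambda>x. (A x * A' x) $$ (i, j)) meromorphic_on UNIV"
proof -
  have eq: "(\<lambda>x. (A x * A' x) $$ (i, j)) = (\<lambda>x. \<Sum>l = 0..<n. A x $$ (i, l) * A' x $$ (l, j))"
  proof
    fix x
    have "A x \<in> carrier_mat n n" "A' x \<in> carrier_mat n n" using assms by (auto simp: fun_mat_def)
    then show "(A x * A' x) $$ (i, j) = (\<Sum>l = 0..<n. A x $$ (i, l) * A' x $$ (l, j))"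
      using assms(3,4) by (simp add: scalar_prod_def)
  qed
  have F: "(\<lambda>x. A x $$ (i, l)) \<in> M_fact_C" "(\<lambda>x. A' x $$ (l, j)) \<in> M_fact_C" if "l < n" for l
    using assms that by (auto simp: fun_mat_def)
  show "rationally_approximable (\<lambda>x. (A x * A' x) $$ (i, j))"
    unfolding eq
    by (intro rationally_approximable_sum rationally_approximable_mult)
       (use F in \<open>auto simp: M_fact_C_def intro: rationally_approximable_M_fact\<close>)
  show "(\<lambda>x. (A x * A' x) $$ (i, j)) meromorphic_on UNIV"
    unfolding eq using F by (intro meromorphic_intros) (auto simp: M_fact_C_def)
qed

theorem mainTheorem5:
  fixes n :: nat and B Y Y' M M' N N' :: "complex \<Rightarrow> complex mat"
  assumes "B \<in> GL n rational_functions"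
    and "regular_singular n B"
    and "normal_form_solution n B Y M N"
    and "normal_form_solution n B Y' M' N'"
  shows "N' = N \<and>
    (\<exists>R. R \<in> carrier_mat n n \<and> invertible_mat R \<and>
         (\<forall>x. R * N x = N x * R) \<and> (\<forall>\<^sub>\<approx>x. M' x = M x * R))"
proof -
  have B: "B \<in> fun_mat n rational_functions" using assms(1) by (simp add: GL_def)
  from assms(3) obtain bs where bs: "block_data n bs"
    and N: "N = (\<lambda>x. block_toeplitz (\<lambda>k c. l_plus k c x) bs)"
    unfolding normal_form_solution_def normal_factor_def e_plus_blocks_eq_block_toeplitz by blast
  from assms(4) obtain bs' where bs': "block_data n bs'"
    and N': "N' = (\<lambda>x. block_toeplitz (\<lambda>k c. l_plus k c x) bs')"
    unfolding normal_form_solution_def normal_factor_def e_plus_blocks_eq_block_toeplitz by blast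
  have size: "total_size bs = n" "total_size bs' = n" using bs bs' by (auto simp: block_data_def)
  from assms(3) obtain V where M: "M \<in> fun_mat n M_fact_C" and V: "V \<in> fun_mat n M_fact_C"
    and MV: "eventually (\<lambda>x. M x * V x = 1\<^sub>m n \<and> V x * M x = 1\<^sub>m n) (cosparse UNIV)"
    unfolding normal_form_solution_def GL_def inverse_fun_mats_def by blast
  from assms(4) obtain V' where M': "M' \<in> fun_mat n M_fact_C" and V': "V' \<in> fun_mat n M_fact_C"
    and MV': "eventually (\<lambda>x. M' x * V' x = 1\<^sub>m n \<and> V' x * M' x = 1\<^sub>m n) (cosparse UNIV)"
    unfolding normal_form_solution_def GL_def inverse_fun_mats_def by blast
  have carr: "M x \<in> carrier_mat n n" "V x \<in> carrier_mat n n" "M' x \<in> carrier_mat n n"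
    "V' x \<in> carrier_mat n n" "B x \<in> carrier_mat n n" for x
    using M V M' V' B by (auto simp: fun_mat_def)
  have T: "block_toeplitz f bs \<in> carrier_mat n n" "block_toeplitz f bs' \<in> carrier_mat n n" for f
    using block_toeplitz_carrier[of f bs] block_toeplitz_carrier[of f bs'] by (simp_all add: size)
  note mult = mult_carrier_mat[where nr = n and n = n and nc = n]
  note assoc = assoc_mult_mat[where n\<^sub>1 = n and n\<^sub>2 = n and n\<^sub>3 = n and n\<^sub>4 = n]
  define P where "P x = V x * M' x" for x
  have P: "P x \<in> carrier_mat n n" for x unfolding P_def by (intro mult carr)
  note coc = eventually_cosparse_imp_cocountable
  have gauge: "eventually (\<lambda>x. M (x - 1) * block_toeplitz (shift_coeff x) bs = B x * M x) cocountable"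
    using assms(3) unfolding normal_form_solution_def N by (intro gauge_equation[OF B M size(1)]) auto
  have gauge': "eventually (\<lambda>x. M' (x - 1) * block_toeplitz (shift_coeff x) bs' = B x * M' x) cocountable"
    using assms(4) unfolding normal_form_solution_def N' by (intro gauge_equation[OF B M' size(2)]) auto
  \<comment> \<open>Inserting \<open>M x * V x = 1\<close> between \<open>B x\<close> and
    \<open>M' x\<close> produces \<open>B x * M x\<close>, to which the equation for
    \<open>M\<close> applies; in this way \<open>B\<close> is eliminated.\<close>
  have rec: "eventually (\<lambda>x. P (x - 1) * block_toeplitz (shift_coeff x) bs' =
      block_toeplitz (shift_coeff x) bs * P x) cocountable"
    using gauge gauge' coc[OF MV] eventually_cocountable_shift[OF coc[OF MV], of 1]
  proof eventually_elim
    case (elim x)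
    let ?A = "block_toeplitz (shift_coeff x) bs" and ?A' = "block_toeplitz (shift_coeff x) bs'"
    have "P (x - 1) * ?A' = V (x - 1) * (M' (x - 1) * ?A')"
      unfolding P_def by (intro assoc carr T)
    also have "\<dots> = V (x - 1) * (B x * (M x * V x) * M' x)"
      using elim(2,3) carr(5)[of x] by simp
    also have "B x * (M x * V x) * M' x = (B x * M x) * P x"
      using carr by (simp add: assoc[OF mult] assoc mult P_def)
    also have "\<dots> = (M (x - 1) * ?A) * P x" using elim(1) by simp
    also have "\<dots> = M (x - 1) * (?A * P x)" by (intro assoc carr T P)
    also have "V (x - 1) * \<dots> = (V (x - 1) * M (x - 1)) * (?A * P x)"
      by (intro assoc[symmetric] carr mult T P)
    also have "\<dots> = ?A * P x" using elim(4) left_mult_one_mat[OF mult[OF T(1) P]] by simp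
    finally show ?case .
  qed
  \<comment> \<open>Both real parts lie in a half-open interval of length 1, so an integral
    difference must be 0.\<close>
  have nonres: "k = 0" if "c \<in> fst ` set bs" "c' \<in> fst ` set bs'" "c' - c = of_int k" for c c' k
  proof -
    have "0 < Re c" "Re c \<le> 1" "0 < Re c'" "Re c' \<le> 1"
      using bs bs' that(1,2) by (auto simp: block_data_def)
    moreover have "Re c' - Re c = real_of_int k" using arg_cong[OF that(3), of Re] by simp
    ultimately show ?thesis by linarith
  qed
  obtain R where R: "R \<in> carrier_mat n n" and PR: "eventually (\<lambda>x. P x = R) (cosparse UNIV)"
    and inter: "block_toeplitz jordan_coeff bs * R = R * block_toeplitz jordan_coeff bs'"
    by (rule intertwiner_constant[OF size P _ _ nonres rec])
       (auto simp: P_def intro: fun_mat_mult_entry[OF V M'])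
  \<comment> \<open>\<open>V' x * M x\<close> inverts \<open>P x\<close> off a countable set; as
    \<open>R\<close> does not depend on \<open>x\<close>, a single such point yields an inverse of
    \<open>R\<close>.\<close>
  have "eventually (\<lambda>_. \<exists>W\<in>carrier_mat n n. R * W = 1\<^sub>m n) cocountable"
    using coc[OF PR] coc[OF MV] coc[OF MV']
  proof eventually_elim
    case (elim x)
    have "P x * (V' x * M x) = V x * (M' x * (V' x * M x))"
      unfolding P_def by (intro assoc carr mult)
    also have "M' x * (V' x * M x) = (M' x * V' x) * M x" by (intro assoc[symmetric] carr)
    also have "\<dots> = M x" using elim(3) carr(1)[of x] by simp
    finally have "R * (V' x * M x) = 1\<^sub>m n" using elim by simp
    then show ?case using mult[OF carr(4,1)] by blast
  qed
  then obtain W where W: "W \<in> carrier_mat n n" "R * W = 1\<^sub>m n"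
    using constant_of_eventually_cocountable by blast
  have WR: "W * R = 1\<^sub>m n" by (rule mat_mult_left_right_inverse[OF R W])
  have bs_eq: "bs = bs'" by (rule similar_jordan_matrices_imp_eq[OF bs bs' R W WR inter])
  have "invertible_mat R"
    using R W WR unfolding invertible_mat_def inverts_mat_def by (intro conjI exI[of _ W]) auto
  moreover have "R * N x = N x * R" for x
    unfolding N using commutes_with_block_toeplitz[of R bs] R inter bs_eq size by simp
  moreover have "eventually (\<lambda>x. M' x = M x * R) (cosparse UNIV)"
    using PR MV
  proof eventually_elim
    case (elim x)
    have "M x * R = M x * (V x * M' x)" using elim(1) by (simp add: P_def)
    also have "\<dots> = (M x * V x) * M' x" by (intro assoc[symmetric] carr)
    also have "\<dots> = M' x" using elim(2) carr(3)[of x] by simp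
    finally show ?case ..
  qed
  ultimately show ?thesis using R unfolding N N' bs_eq by blast
qed

end
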